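(* (Provable in $\mathbf{HA}^\omega$.) Let $\tau,\sigma$ be finite types and $i=\max\{1+\mathrm{level}(\tau),\mathrm{level}(\sigma)\}$. Let $t\colon\tau^{\mathbb N}\to\mathbb N$ be a closed term in $\mathsf T_i$. Then there is a $\mathsf T_i$-term $\Phi^t$ such that for any bar $S$ securing $t$ and any $\Delta\colon(\tau^*\to\sigma)\to(\tau^*\to(\tau\to\sigma)\to\sigma)\to\tau^*\to\sigma$, $$\mathcal{GBR}_S(\Delta)\quad\Rightarrow\quad\mathcal{BR}(\Phi^t(\Delta),Y=t).$$
   Context: Finite types: $\mathbb N$ is a finite type, and if $\tau_0,\tau_1$ are finite types then so are $\tau_0\to\tau_1$ (also written $\tau_1^{\tau_0}$) and $\tau_0^*$ (finite sequences). Type levels: $\mathrm{level}(\mathbb N)=0$, $\mathrm{level}(\rho\to\eta)=\max\{\mathrm{level}(\rho)+1,\mathrm{level}(\eta)\}$, $\mathrm{level}(\tau^* )=\mathrm{level}(\tau)$. System $\mathsf T$ is the simply typed $\lambda$-calculus with $0$, $\mathsf{Succ}$ and recursors $\mathsf{Rec}^\rho$ for every finite type $\rho$, with $\mathsf{Rec}^\rho(a,f)(0)=a$, $\mathsf{Rec}^\rho(a,f)(\mathsf{Succ}(m))=f(m,\mathsf{Rec}^\rho(a,f)(m))$. $\mathsf T_i$ is the fragment in which $\mathsf{Rec}^\rho$ is restricted to $\mathrm{level}(\rho)\le i$. $\mathbf{HA}^\omega$ is intuitionistic Heyting arithmetic in all finite types. Notation: $|s|$ is the length of $s\colon\tau^*$;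 $s*x$ is $s$ with $x\colon\tau$ appended; $s*t$ and $s*\beta$ denote concatenation of $s$ with a finite sequence $t$ or infinite sequence $\beta\colon\tau^{\mathbb N}$; $\hat s\colon\mathbb N\to\tau$ extends $s$ by infinitely many zero objects $0^\tau$; $\bar\alpha n=\langle\alpha(0),\dots,\alpha(n-1)\rangle$. Bars: a predicate $S(s^{\tau^*})$ is a bar if it is (i) decidable: $\forall s(S(s)\vee\neg S(s))$; (ii) $\forall\alpha^{\tau^{\mathbb N}}\exists n^{\mathbb N}S(\bar\alpha n)$; (iii) monotone: $\forall s,t\,(S(s)\to S(s*t))$. A bar $S$ secures $Y\colon\tau^{\mathbb N}\to\mathbb N$ if for all $s^{\tau^*}$, $S(s)$ implies that $\lambda\beta.Y(s*\beta)$ is constant. For $\xi\colon(\tau^*\to\sigma)\to(\tau^*\to(\tau\to\sigma)\to\sigma)\to\tau^*\to\sigma$: - $\mathcal{GBR}_S(\xi)$ (general bar recursion) says: for all $G\colon\tau^*\to\sigma$, $H\colon\tau^*\to(\tau\to\sigma)\to\sigma$, $s\colon\tau^*$, if $S(s)$ then $\xi(G,H)(s)=G(s)$, and if $\neg S(s)$ then $\xi(G,H)(s)=H(s)(\lambda x^\tau.\xi(G,H)(s*x))$. - $\mathcal{BR}(\xi,Y=t)$ (Spector's bar recursion with $Y$ fixed to be $t$) says: for all $G,H,s$ of the same types, if $t(\hat s)<|s|$ then $\xi(G,H)(s)=G(s)$, and if $t(\hat s)\ge|s|$ then $\xi(G,H)(s)=H(s)(\lambda x^\tau.\xi(G,H)(s*x))$.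 *)

theory Defs
  imports Main
begin

section \<open>Finite types\<close>

datatype ty =
    NatT
  | Fun ty ty  (infixr "\<rightarrow>\<^sub>t" 60)
  | SeqT ty

fun level :: "ty \<Rightarrow> nat" where
  "level NatT = 0"
| "level (\<rho> \<rightarrow>\<^sub>t \<eta>) = max (level \<rho> + 1) (level \<eta>)"
| "level (SeqT \<tau>) = level \<tau>"


section \<open>Terms of system T\<close>

text \<open>
  Terms of the simply typed lambda calculus with de Bruijn indices and typed abstractions.
  Finite sequences are a primitive type former, so the elementary operations on them are constants:
  the empty sequence, \<open>s * x\<close> (\<open>Snoc\<close>), the length \<open>|s|\<close> (\<open>Len\<close>) and the extension of \<open>s\<close> by
  infinitely many zero objects (\<open>Hat\<close>). None of them recurses on a result type; the only recursors
  are the \<open>Rec \<rho>\<close>, and all other operations on sequences are defined from these.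
\<close>

datatype tm =
    Var nat
  | App tm tm  (infixl "\<cdot>" 100)
  | Lam ty tm
  | Zero
  | Succ
  | Rec ty
  | Emp ty
  | Snoc ty
  | Len ty
  | Hat ty

inductive typed :: "ty list \<Rightarrow> tm \<Rightarrow> ty \<Rightarrow> bool" where
  Var: "n < length \<Gamma> \<Longrightarrow> typed \<Gamma> (Var n) (\<Gamma> ! n)"
| App: "typed \<Gamma> f (\<rho> \<rightarrow>\<^sub>t \<eta>) \<Longrightarrow> typed \<Gamma> a \<rho> \<Longrightarrow> typed \<Gamma> (f \<cdot> a) \<eta>"
| Lam: "typed (\<rho> # \<Gamma>) b \<eta> \<Longrightarrow> typed \<Gamma> (Lam \<rho> b) (\<rho> \<rightarrow>\<^sub>t \<eta>)"
| Zero: "typed \<Gamma> Zero NatT"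
| Succ: "typed \<Gamma> Succ (NatT \<rightarrow>\<^sub>t NatT)"
| Rec: "typed \<Gamma> (Rec \<rho>) (\<rho> \<rightarrow>\<^sub>t (NatT \<rightarrow>\<^sub>t \<rho> \<rightarrow>\<^sub>t \<rho>) \<rightarrow>\<^sub>t NatT \<rightarrow>\<^sub>t \<rho>)"
| Emp: "typed \<Gamma> (Emp \<tau>) (SeqT \<tau>)"
| Snoc: "typed \<Gamma> (Snoc \<tau>) (SeqT \<tau> \<rightarrow>\<^sub>t \<tau> \<rightarrow>\<^sub>t SeqT \<tau>)"
| Len: "typed \<Gamma> (Len \<tau>) (SeqT \<tau> \<rightarrow>\<^sub>t NatT)"
| Hat: "typed \<Gamma> (Hat \<tau>) (SeqT \<tau> \<rightarrow>\<^sub>t NatT \<rightarrow>\<^sub>t \<tau>)"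

text \<open>The fragment \<open>T\<^sub>i\<close>: recursors only at types of level at most \<open>i\<close>.\<close>

fun in_T :: "nat \<Rightarrow> tm \<Rightarrow> bool" where
  "in_T i (f \<cdot> a) \<longleftrightarrow> in_T i f \<and> in_T i a"
| "in_T i (Lam \<rho> b) \<longleftrightarrow> in_T i b"
| "in_T i (Rec \<rho>) \<longleftrightarrow> level \<rho> \<le> i"
| "in_T i _ \<longleftrightarrow> True"

definition up_ren :: "(nat \<Rightarrow> nat) \<Rightarrow> nat \<Rightarrow> nat" where
  "up_ren r = case_nat 0 (\<lambda>n. Suc (r n))"

fun rename :: "(nat \<Rightarrow> nat) \<Rightarrow> tm \<Rightarrow> tm" where
  "rename r (Var n) = Var (r n)"
| "rename r (f \<cdot> a) = rename r f \<cdot> rename r a"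
| "rename r (Lam \<rho> b) = Lam \<rho> (rename (up_ren r) b)"
| "rename r c = c"

definition shift :: "nat \<Rightarrow> tm \<Rightarrow> tm" where
  "shift k = rename (\<lambda>n. n + k)"

definition up_sub :: "(nat \<Rightarrow> tm) \<Rightarrow> nat \<Rightarrow> tm" where
  "up_sub \<theta> = case_nat (Var 0) (\<lambda>n. shift 1 (\<theta> n))"

fun subst :: "(nat \<Rightarrow> tm) \<Rightarrow> tm \<Rightarrow> tm" where
  "subst \<theta> (Var n) = \<theta> n"
| "subst \<theta> (f \<cdot> a) = subst \<theta> f \<cdot> subst \<theta> a"
| "subst \<theta> (Lam \<rho> b) = Lam \<rho> (subst (up_sub \<theta>) b)"
| "subst \<theta> c = c"

text \<open>\<open>inst u k\<close> replaces index 0 by \<open>u\<close>; the remaining indices are renumbered so that \<open>k\<close> further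
  bound variables (which \<open>u\<close> may mention) come in front of them.\<close>

definition inst :: "tm \<Rightarrow> nat \<Rightarrow> nat \<Rightarrow> tm" where
  "inst u k = case_nat u (\<lambda>n. Var (n + k))"


section \<open>Defined operations of system T\<close>

fun zero_obj :: "ty \<Rightarrow> tm" where
  "zero_obj NatT = Zero"
| "zero_obj (\<rho> \<rightarrow>\<^sub>t \<eta>) = Lam \<rho> (zero_obj \<eta>)"
| "zero_obj (SeqT \<tau>) = Emp \<tau>"

definition add :: "tm \<Rightarrow> tm \<Rightarrow> tm" where
  "add a b = Rec NatT \<cdot> a \<cdot> Lam NatT (Lam NatT (Succ \<cdot> Var 0)) \<cdot> b"

definition pred :: "tm \<Rightarrow> tm" where
  "pred a = Rec NatT \<cdot> Zero \<cdot> Lam NatT (Lam NatT (Var 1)) \<cdot> a"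

text \<open>Truncated subtraction.\<close>

definition monus :: "tm \<Rightarrow> tm \<Rightarrow> tm" where
  "monus a b = Rec NatT \<cdot> a \<cdot> Lam NatT (Lam NatT (pred (Var 0))) \<cdot> b"

definition if_zero :: "ty \<Rightarrow> tm \<Rightarrow> tm \<Rightarrow> tm \<Rightarrow> tm" where
  "if_zero \<rho> c a b = Rec \<rho> \<cdot> a \<cdot> Lam NatT (Lam \<rho> (shift 2 b)) \<cdot> c"

text \<open>\<open>s * u\<close> for a finite sequence \<open>u\<close>: append the entries of \<open>u\<close> one by one.\<close>

definition concat_fin :: "ty \<Rightarrow> tm \<Rightarrow> tm \<Rightarrow> tm" where
  "concat_fin \<tau> s u =
     Rec (SeqT \<tau>) \<cdot> s
       \<cdot> Lam NatT (Lam (SeqT \<tau>) (Snoc \<tau> \<cdot> Var 0 \<cdot> (Hat \<tau> \<cdot> shift 2 u \<cdot> Var 1)))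
       \<cdot> (Len \<tau> \<cdot> u)"

text \<open>\<open>s * \<beta>\<close> for an infinite sequence \<open>\<beta>\<close>: the entry at \<open>n\<close> is \<open>\<beta> (n - |s|)\<close> if \<open>|s| - n = 0\<close>, and
  the entry of \<open>s\<close> at \<open>n\<close> otherwise.\<close>

definition concat_inf :: "ty \<Rightarrow> tm \<Rightarrow> tm \<Rightarrow> tm" where
  "concat_inf \<tau> s \<beta> =
     Lam NatT (if_zero \<tau> (monus (Len \<tau> \<cdot> shift 1 s) (Var 0))
       (shift 1 \<beta> \<cdot> monus (Var 0) (Len \<tau> \<cdot> shift 1 s))
       (Hat \<tau> \<cdot> shift 1 s \<cdot> Var 0))"

text \<open>The initial segment \<open>\<langle>\<alpha> 0, \<dots>, \<alpha> (n - 1)\<rangle>\<close>.\<close>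

definition init_seg :: "ty \<Rightarrow> tm \<Rightarrow> tm \<Rightarrow> tm" where
  "init_seg \<tau> \<alpha> n =
     Rec (SeqT \<tau>) \<cdot> Emp \<tau>
       \<cdot> Lam NatT (Lam (SeqT \<tau>) (Snoc \<tau> \<cdot> Var 0 \<cdot> (shift 2 \<alpha> \<cdot> Var 1))) \<cdot> n"


section \<open>Formulas\<close>

datatype fm =
    Eq ty tm tm
  | Fls
  | Conj fm fm  (infixr "\<^bold>\<and>" 35)
  | Disj fm fm  (infixr "\<^bold>\<or>" 30)
  | Imp fm fm  (infixr "\<^bold>\<longrightarrow>" 25)
  | All ty fm
  | Ex ty fm

abbreviation Neg :: "fm \<Rightarrow> fm"  ("\<^bold>\<not> _" [40] 40) where
  "\<^bold>\<not> \<phi> \<equiv> \<phi> \<^bold>\<longrightarrow> Fls"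

fun wf_fm :: "ty list \<Rightarrow> fm \<Rightarrow> bool" where
  "wf_fm \<Gamma> (Eq \<rho> a b) \<longleftrightarrow> typed \<Gamma> a \<rho> \<and> typed \<Gamma> b \<rho>"
| "wf_fm \<Gamma> Fls \<longleftrightarrow> True"
| "wf_fm \<Gamma> (\<phi> \<^bold>\<and> \<psi>) \<longleftrightarrow> wf_fm \<Gamma> \<phi> \<and> wf_fm \<Gamma> \<psi>"
| "wf_fm \<Gamma> (\<phi> \<^bold>\<or> \<psi>) \<longleftrightarrow> wf_fm \<Gamma> \<phi> \<and> wf_fm \<Gamma> \<psi>"
| "wf_fm \<Gamma> (\<phi> \<^bold>\<longrightarrow> \<psi>) \<longleftrightarrow> wf_fm \<Gamma> \<phi> \<and> wf_fm \<Gamma> \<psi>"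
| "wf_fm \<Gamma> (All \<rho> \<phi>) \<longleftrightarrow> wf_fm (\<rho> # \<Gamma>) \<phi>"
| "wf_fm \<Gamma> (Ex \<rho> \<phi>) \<longleftrightarrow> wf_fm (\<rho> # \<Gamma>) \<phi>"

fun subst_fm :: "(nat \<Rightarrow> tm) \<Rightarrow> fm \<Rightarrow> fm" where
  "subst_fm \<theta> (Eq \<rho> a b) = Eq \<rho> (subst \<theta> a) (subst \<theta> b)"
| "subst_fm \<theta> Fls = Fls"
| "subst_fm \<theta> (\<phi> \<^bold>\<and> \<psi>) = (subst_fm \<theta> \<phi> \<^bold>\<and> subst_fm \<theta> \<psi>)"
| "subst_fm \<theta> (\<phi> \<^bold>\<or> \<psi>) = (subst_fm \<theta> \<phi> \<^bold>\<or> subst_fm \<theta> \<psi>)"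
| "subst_fm \<theta> (\<phi> \<^bold>\<longrightarrow> \<psi>) = (subst_fm \<theta> \<phi> \<^bold>\<longrightarrow> subst_fm \<theta> \<psi>)"
| "subst_fm \<theta> (All \<rho> \<phi>) = All \<rho> (subst_fm (up_sub \<theta>) \<phi>)"
| "subst_fm \<theta> (Ex \<rho> \<phi>) = Ex \<rho> (subst_fm (up_sub \<theta>) \<phi>)"

definition shift_fm :: "fm \<Rightarrow> fm" where
  "shift_fm = subst_fm (\<lambda>n. Var (n + 1))"

definition le_fm :: "tm \<Rightarrow> tm \<Rightarrow> fm" where
  "le_fm a b = Ex NatT (Eq NatT (add (shift 1 a) (Var 0)) (shift 1 b))"

definition less_fm :: "tm \<Rightarrow> tm \<Rightarrow> fm" where
  "less_fm a b = le_fm (Succ \<cdot> a) b"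


section \<open>Heyting arithmetic in all finite types\<close>

text \<open>
  \<open>HA \<Gamma> A \<phi>\<close>: the formula \<open>\<phi>\<close>, whose free variables have the types listed in \<open>\<Gamma>\<close>, is derivable
  from the assumptions \<open>A\<close> by intuitionistic natural deduction. Equality is available at every finite
  type and is extensional at function types (\<open>Ext\<close>).
\<close>

inductive HA :: "ty list \<Rightarrow> fm set \<Rightarrow> fm \<Rightarrow> bool" where
  Assm: "\<phi> \<in> A \<Longrightarrow> wf_fm \<Gamma> \<phi> \<Longrightarrow> HA \<Gamma> A \<phi>"
| FlsE: "HA \<Gamma> A Fls \<Longrightarrow> wf_fm \<Gamma> \<phi> \<Longrightarrow> HA \<Gamma> A \<phi>"
| ConjI: "HA \<Gamma> A \<phi> \<Longrightarrow> HA \<Gamma> A \<psi> \<Longrightarrow> HA \<Gamma> A (\<phi> \<^bold>\<and> \<psi>)"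
| ConjE1: "HA \<Gamma> A (\<phi> \<^bold>\<and> \<psi>) \<Longrightarrow> HA \<Gamma> A \<phi>"
| ConjE2: "HA \<Gamma> A (\<phi> \<^bold>\<and> \<psi>) \<Longrightarrow> HA \<Gamma> A \<psi>"
| DisjI1: "HA \<Gamma> A \<phi> \<Longrightarrow> wf_fm \<Gamma> \<psi> \<Longrightarrow> HA \<Gamma> A (\<phi> \<^bold>\<or> \<psi>)"
| DisjI2: "HA \<Gamma> A \<psi> \<Longrightarrow> wf_fm \<Gamma> \<phi> \<Longrightarrow> HA \<Gamma> A (\<phi> \<^bold>\<or> \<psi>)"
| DisjE: "HA \<Gamma> A (\<phi> \<^bold>\<or> \<psi>) \<Longrightarrow> HA \<Gamma> (insert \<phi> A) \<chi> \<Longrightarrow> HA \<Gamma> (insert \<psi> A) \<chi> \<Longrightarrow> HA \<Gamma> A \<chi>"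
| ImpI: "wf_fm \<Gamma> \<phi> \<Longrightarrow> HA \<Gamma> (insert \<phi> A) \<psi> \<Longrightarrow> HA \<Gamma> A (\<phi> \<^bold>\<longrightarrow> \<psi>)"
| ImpE: "HA \<Gamma> A (\<phi> \<^bold>\<longrightarrow> \<psi>) \<Longrightarrow> HA \<Gamma> A \<phi> \<Longrightarrow> HA \<Gamma> A \<psi>"
| AllI: "HA (\<rho> # \<Gamma>) (shift_fm ` A) \<phi> \<Longrightarrow> HA \<Gamma> A (All \<rho> \<phi>)"
| AllE: "HA \<Gamma> A (All \<rho> \<phi>) \<Longrightarrow> typed \<Gamma> u \<rho> \<Longrightarrow> HA \<Gamma> A (subst_fm (inst u 0) \<phi>)"
| ExI: "wf_fm (\<rho> # \<Gamma>) \<phi> \<Longrightarrow> typed \<Gamma> u \<rho> \<Longrightarrow> HA \<Gamma> A (subst_fm (inst u 0) \<phi>) \<Longrightarrow> HA \<Gamma> A (Ex \<rho> \<phi>)"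
| ExE: "HA \<Gamma> A (Ex \<rho> \<phi>) \<Longrightarrow> wf_fm \<Gamma> \<chi> \<Longrightarrow>
    HA (\<rho> # \<Gamma>) (insert \<phi> (shift_fm ` A)) (shift_fm \<chi>) \<Longrightarrow> HA \<Gamma> A \<chi>"
  \<comment> \<open>equality\<close>
| Refl: "typed \<Gamma> u \<rho> \<Longrightarrow> HA \<Gamma> A (Eq \<rho> u u)"
| Leibniz: "wf_fm (\<rho> # \<Gamma>) \<phi> \<Longrightarrow> HA \<Gamma> A (Eq \<rho> u v) \<Longrightarrow>
    HA \<Gamma> A (subst_fm (inst u 0) \<phi>) \<Longrightarrow> HA \<Gamma> A (subst_fm (inst v 0) \<phi>)"
| Ext: "typed \<Gamma> f (\<rho> \<rightarrow>\<^sub>t \<eta>) \<Longrightarrow> typed \<Gamma> g (\<rho> \<rightarrow>\<^sub>t \<eta>) \<Longrightarrow>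
    HA \<Gamma> A (All \<rho> (Eq \<eta> (shift 1 f \<cdot> Var 0) (shift 1 g \<cdot> Var 0))) \<Longrightarrow>
    HA \<Gamma> A (Eq (\<rho> \<rightarrow>\<^sub>t \<eta>) f g)"
| Beta: "typed (\<rho> # \<Gamma>) b \<eta> \<Longrightarrow> typed \<Gamma> u \<rho> \<Longrightarrow>
    HA \<Gamma> A (Eq \<eta> (Lam \<rho> b \<cdot> u) (subst (inst u 0) b))"
  \<comment> \<open>arithmetic\<close>
| Succ_not_Zero: "typed \<Gamma> u NatT \<Longrightarrow> HA \<Gamma> A (\<^bold>\<not> Eq NatT (Succ \<cdot> u) Zero)"
| Succ_inj: "typed \<Gamma> u NatT \<Longrightarrow> typed \<Gamma> v NatT \<Longrightarrow>
    HA \<Gamma> A (Eq NatT (Succ \<cdot> u) (Succ \<cdot> v) \<^bold>\<longrightarrow> Eq NatT u v)"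
| Nat_induct: "HA \<Gamma> A (subst_fm (inst Zero 0) \<phi>) \<Longrightarrow>
    HA \<Gamma> A (All NatT (\<phi> \<^bold>\<longrightarrow> subst_fm (inst (Succ \<cdot> Var 0) 1) \<phi>)) \<Longrightarrow>
    HA \<Gamma> A (All NatT \<phi>)"
| Rec_Zero: "typed \<Gamma> a \<rho> \<Longrightarrow> typed \<Gamma> f (NatT \<rightarrow>\<^sub>t \<rho> \<rightarrow>\<^sub>t \<rho>) \<Longrightarrow>
    HA \<Gamma> A (Eq \<rho> (Rec \<rho> \<cdot> a \<cdot> f \<cdot> Zero) a)"
| Rec_Succ: "typed \<Gamma> a \<rho> \<Longrightarrow> typed \<Gamma> f (NatT \<rightarrow>\<^sub>t \<rho> \<rightarrow>\<^sub>t \<rho>) \<Longrightarrow> typed \<Gamma> m NatT \<Longrightarrow>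
    HA \<Gamma> A (Eq \<rho> (Rec \<rho> \<cdot> a \<cdot> f \<cdot> (Succ \<cdot> m)) (f \<cdot> m \<cdot> (Rec \<rho> \<cdot> a \<cdot> f \<cdot> m)))"
  \<comment> \<open>finite sequences\<close>
| Seq_induct: "HA \<Gamma> A (subst_fm (inst (Emp \<tau>) 0) \<phi>) \<Longrightarrow>
    HA \<Gamma> A (All (SeqT \<tau>) (\<phi> \<^bold>\<longrightarrow> All \<tau> (subst_fm (inst (Snoc \<tau> \<cdot> Var 1 \<cdot> Var 0) 2) \<phi>))) \<Longrightarrow>
    HA \<Gamma> A (All (SeqT \<tau>) \<phi>)"
| Len_Emp: "HA \<Gamma> A (Eq NatT (Len \<tau> \<cdot> Emp \<tau>) Zero)"
| Len_Snoc: "typed \<Gamma> s (SeqT \<tau>) \<Longrightarrow> typed \<Gamma> x \<tau> \<Longrightarrow>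
    HA \<Gamma> A (Eq NatT (Len \<tau> \<cdot> (Snoc \<tau> \<cdot> s \<cdot> x)) (Succ \<cdot> (Len \<tau> \<cdot> s)))"
| Hat_Emp: "typed \<Gamma> n NatT \<Longrightarrow> HA \<Gamma> A (Eq \<tau> (Hat \<tau> \<cdot> Emp \<tau> \<cdot> n) (zero_obj \<tau>))"
| Hat_Snoc_last: "typed \<Gamma> s (SeqT \<tau>) \<Longrightarrow> typed \<Gamma> x \<tau> \<Longrightarrow>
    HA \<Gamma> A (Eq \<tau> (Hat \<tau> \<cdot> (Snoc \<tau> \<cdot> s \<cdot> x) \<cdot> (Len \<tau> \<cdot> s)) x)"
| Hat_Snoc_other: "typed \<Gamma> s (SeqT \<tau>) \<Longrightarrow> typed \<Gamma> x \<tau> \<Longrightarrow> typed \<Gamma> n NatT \<Longrightarrow>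
    HA \<Gamma> A (\<^bold>\<not> Eq NatT n (Len \<tau> \<cdot> s) \<^bold>\<longrightarrow>
      Eq \<tau> (Hat \<tau> \<cdot> (Snoc \<tau> \<cdot> s \<cdot> x) \<cdot> n) (Hat \<tau> \<cdot> s \<cdot> n))"


section \<open>Bars and bar recursion\<close>

text \<open>
  A predicate on \<open>\<tau>\<^sup>*\<close> in the context \<open>\<Gamma>\<close> is a formula \<open>S\<close> in the context \<open>SeqT \<tau> # \<Gamma>\<close>: index 0 is
  the sequence, the other indices are parameters. \<open>at S k u\<close> is \<open>S(u)\<close> underneath \<open>k\<close> additional
  binders, and \<open>weaken_pred S\<close> is \<open>S\<close> in the context \<open>SeqT \<tau> # \<rho> # \<Gamma>\<close>.
\<close>

definition at :: "fm \<Rightarrow> nat \<Rightarrow> tm \<Rightarrow> fm" where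
  "at S k u = subst_fm (inst u k) S"

definition weaken_pred :: "fm \<Rightarrow> fm" where
  "weaken_pred S = at S 2 (Var 0)"

text \<open>The comments inside the formulas below name the bound variables, outermost first.\<close>

definition is_bar :: "ty \<Rightarrow> fm \<Rightarrow> fm" where
  "is_bar \<tau> S =
    (All (SeqT \<tau>) (at S 1 (Var 0) \<^bold>\<or> \<^bold>\<not> at S 1 (Var 0))
     \<comment> \<open>\<open>\<alpha>, n\<close>\<close>
     \<^bold>\<and> All (NatT \<rightarrow>\<^sub>t \<tau>) (Ex NatT (at S 2 (init_seg \<tau> (Var 1) (Var 0))))
     \<comment> \<open>\<open>s, t\<close>\<close>
     \<^bold>\<and> All (SeqT \<tau>) (All (SeqT \<tau>)
          (at S 2 (Var 1) \<^bold>\<longrightarrow> at S 2 (concat_fin \<tau> (Var 1) (Var 0)))))"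

definition secures :: "ty \<Rightarrow> fm \<Rightarrow> tm \<Rightarrow> fm" where
  "secures \<tau> S Y =
     \<comment> \<open>\<open>s\<close>, then \<open>\<beta>, \<gamma>\<close>\<close>
     All (SeqT \<tau>) (at S 1 (Var 0) \<^bold>\<longrightarrow>
       All (NatT \<rightarrow>\<^sub>t \<tau>) (All (NatT \<rightarrow>\<^sub>t \<tau>)
         (Eq NatT (shift 3 Y \<cdot> concat_inf \<tau> (Var 2) (Var 1))
                  (shift 3 Y \<cdot> concat_inf \<tau> (Var 2) (Var 0)))))"

definition br_ty :: "ty \<Rightarrow> ty \<Rightarrow> ty" where
  "br_ty \<tau> \<sigma> =
     (SeqT \<tau> \<rightarrow>\<^sub>t \<sigma>) \<rightarrow>\<^sub>t (SeqT \<tau> \<rightarrow>\<^sub>t (\<tau> \<rightarrow>\<^sub>t \<sigma>) \<rightarrow>\<^sub>t \<sigma>) \<rightarrow>\<^sub>t SeqT \<tau> \<rightarrow>\<^sub>t \<sigma>"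

text \<open>\<open>bar_rec\<close> quantifies over \<open>G, H, s\<close> and states both equations of a bar recursor \<open>\<xi>\<close>, where
  \<open>stop\<close> and \<open>continue\<close> (in the context extended by \<open>G, H, s\<close>) are the two case conditions.\<close>

definition bar_rec :: "ty \<Rightarrow> ty \<Rightarrow> fm \<Rightarrow> fm \<Rightarrow> tm \<Rightarrow> fm" where
  "bar_rec \<tau> \<sigma> stop continue \<xi> =
     All (SeqT \<tau> \<rightarrow>\<^sub>t \<sigma>) (All (SeqT \<tau> \<rightarrow>\<^sub>t (\<tau> \<rightarrow>\<^sub>t \<sigma>) \<rightarrow>\<^sub>t \<sigma>) (All (SeqT \<tau>)
       ((stop \<^bold>\<longrightarrow> Eq \<sigma> (shift 3 \<xi> \<cdot> Var 2 \<cdot> Var 1 \<cdot> Var 0) (Var 2 \<cdot> Var 0))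
        \<^bold>\<and> (continue \<^bold>\<longrightarrow>
             Eq \<sigma> (shift 3 \<xi> \<cdot> Var 2 \<cdot> Var 1 \<cdot> Var 0)
               \<comment> \<open>inside the abstraction over \<open>x\<close> the indices of \<open>G, H, s\<close> are 3, 2, 1\<close>
               (Var 1 \<cdot> Var 0 \<cdot>
                 Lam \<tau> (shift 4 \<xi> \<cdot> Var 3 \<cdot> Var 2 \<cdot> (Snoc \<tau> \<cdot> Var 1 \<cdot> Var 0)))))))"

definition GBR :: "ty \<Rightarrow> ty \<Rightarrow> fm \<Rightarrow> tm \<Rightarrow> fm" where
  "GBR \<tau> \<sigma> S \<xi> = bar_rec \<tau> \<sigma> (at S 3 (Var 0)) (\<^bold>\<not> at S 3 (Var 0)) \<xi>"

definition BR :: "ty \<Rightarrow> ty \<Rightarrow> tm \<Rightarrow> tm \<Rightarrow> fm" where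
  "BR \<tau> \<sigma> \<xi> Y =
     bar_rec \<tau> \<sigma>
       (less_fm (shift 3 Y \<cdot> (Hat \<tau> \<cdot> Var 0)) (Len \<tau> \<cdot> Var 0))
       (le_fm (Len \<tau> \<cdot> Var 0) (shift 3 Y \<cdot> (Hat \<tau> \<cdot> Var 0))) \<xi>"

end

theory Submission
  imports Defs
begin

text \<open>
  On a sequence \<open>s\<close> in the bar, \<open>t\<close> has the same value on all extensions of \<open>s\<close>, so Spector's recursion
  below \<open>s\<close> stops after exactly \<open>k s = (t (hat s) + 1) - |s|\<close> further steps and is a primitive recursion
  of type \<open>\<tau>\<^sup>* \<rightarrow> \<sigma>\<close>, a type of level \<open>i\<close>. The given bar recursor is run with this primitive recursion
  as its stopping function and with the step function that returns \<open>G s\<close> if \<open>k s = 0\<close> and calls \<open>H\<close>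
  otherwise. Both equations follow by deciding whether \<open>s\<close> is in the bar.
\<close>

section \<open>Substitution and typing\<close>

text \<open>\<open>\<Phi>\<close> is chosen before the bar, so it may only compute with
  \<open>t\<close>; \<open>S\<close> is consulted in the correctness proof alone, through its
  decidability. Both functions handed to the given recursor must therefore be correct wherever the
  bar lies. Spector's condition may hold before the bar is reached, hence the test in the step
  function; the bar may be reached before the condition holds, hence the iteration in the stopping
  function. Crossing the border costs nothing: outside the bar, the recursive calls of the given
  recursor are already calls of \<open>\<Phi>\<close>, whatever the status of \<open>s * x\<close>.
  Inside, monotonicity keeps \<open>s * x\<close> in the bar, securing keeps the value of
  \<open>t\<close>, and the length grows by one, so the number of remaining steps drops by exactly
  one.

  All of this happens inside the formal calculus, so the arithmetic of truncated subtraction has to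
  be derived there. The recursive calls stand under an abstraction over \<open>x\<close>; equalities
  below it come from extensionality in a context with one more variable, and the hypotheses on
  \<open>S\<close> have to be carried into that context.\<close>

lemma up_sub_simps [simp]: "up_sub \<theta> 0 = Var 0" "up_sub \<theta> (Suc n) = shift 1 (\<theta> n)"
  by (simp_all add: up_sub_def)

lemma inst_simps [simp]: "inst u k 0 = u" "inst u k (Suc n) = Var (n + k)"
  by (simp_all add: inst_def)

lemma up_ren_simps [simp]: "up_ren r 0 = 0" "up_ren r (Suc n) = Suc (r n)"
  by (simp_all add: up_ren_def)

lemma rename_rename: "rename r (rename q u) = rename (\<lambda>n. r (q n)) u"
proof (induction u arbitrary: r q)
  case (Lam \<rho> u)
  have "(\<lambda>n. up_ren r (up_ren q n)) = up_ren (\<lambda>n. r (q n))"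
    by (rule ext) (simp add: up_ren_def split: nat.split)
  with Lam show ?case by simp
qed simp_all

lemma subst_rename: "subst \<theta> (rename r u) = subst (\<lambda>n. \<theta> (r n)) u"
proof (induction u arbitrary: r \<theta>)
  case (Lam \<rho> u)
  have "(\<lambda>n. up_sub \<theta> (up_ren r n)) = up_sub (\<lambda>n. \<theta> (r n))"
    by (rule ext) (simp add: up_ren_def up_sub_def split: nat.split)
  with Lam show ?case by simp
qed simp_all

lemma rename_subst: "rename r (subst \<theta> u) = subst (\<lambda>n. rename r (\<theta> n)) u"
proof (induction u arbitrary: r \<theta>)
  case (Lam \<rho> u)
  have "(\<lambda>n. rename (up_ren r) (up_sub \<theta> n)) = up_sub (\<lambda>n. rename r (\<theta> n))"
    by (rule ext) (auto simp: up_sub_def shift_def rename_rename split: nat.split)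
  with Lam show ?case by simp
qed simp_all

text \<open>Under a binder \<open>up_sub\<close> shifts, and a shift is a renaming. Both mixed laws
  are therefore needed first, and \<open>rename_subst\<close> in turn needs
  \<open>rename_rename\<close>.\<close>

lemma subst_subst: "subst \<theta> (subst \<psi> u) = subst (\<lambda>n. subst \<theta> (\<psi> n)) u"
proof (induction u arbitrary: \<psi> \<theta>)
  case (Lam \<rho> u)
  have "(\<lambda>n. subst (up_sub \<theta>) (up_sub \<psi> n)) = up_sub (\<lambda>n. subst \<theta> (\<psi> n))"
    by (rule ext) (auto simp: up_sub_def shift_def subst_rename rename_subst split: nat.split)
  with Lam show ?case by simp
qed simp_all

lemma up_sub_Var [simp]: "up_sub Var = Var"
  by (rule ext) (simp add: up_sub_def shift_def split: nat.split)

lemma subst_Var [simp]: "subst Var u = u"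
  by (induction u) simp_all

lemma rename_eq_subst: "rename r u = subst (\<lambda>n. Var (r n)) u"
  using subst_rename[of Var r u] by simp

lemma shift_eq_subst: "shift k u = subst (\<lambda>n. Var (n + k)) u"
  by (simp add: shift_def rename_eq_subst)

lemma up_sub_comp: "up_sub (\<lambda>n. subst \<theta> (\<psi> n)) = (\<lambda>n. subst (up_sub \<theta>) (up_sub \<psi> n))"
  by (rule ext) (auto simp: up_sub_def shift_eq_subst subst_subst split: nat.split)

lemma subst_fm_subst_fm: "subst_fm \<theta> (subst_fm \<psi> \<phi>) = subst_fm (\<lambda>n. subst \<theta> (\<psi> n)) \<phi>"
  by (induction \<phi> arbitrary: \<theta> \<psi>) (simp_all add: subst_subst up_sub_comp)

lemma subst_fm_Var [simp]: "subst_fm Var \<phi> = \<phi>"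
  by (induction \<phi>) simp_all

text \<open>A normal form for index bookkeeping: shifts become substitutions, consecutive
  substitutions are fused, and numerals unfold to \<open>Suc\<close> so that the equations for
  \<open>inst\<close> and \<open>up_sub\<close> apply.\<close>

lemmas substs = shift_eq_subst subst_subst subst_fm_subst_fm shift_fm_def eval_nat_numeral

lemma subst_ops [simp]:
  "subst \<theta> (add a b) = add (subst \<theta> a) (subst \<theta> b)"
  "subst \<theta> (pred a) = pred (subst \<theta> a)"
  "subst \<theta> (monus a b) = monus (subst \<theta> a) (subst \<theta> b)"
  "subst \<theta> (if_zero \<rho> c a b) = if_zero \<rho> (subst \<theta> c) (subst \<theta> a) (subst \<theta> b)"
  "subst \<theta> (concat_fin \<tau> a b) = concat_fin \<tau> (subst \<theta> a) (subst \<theta> b)"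
  "subst \<theta> (init_seg \<tau> a b) = init_seg \<tau> (subst \<theta> a) (subst \<theta> b)"
  by (simp_all add: add_def pred_def monus_def if_zero_def concat_fin_def init_seg_def substs)

lemma subst_concat_inf [simp]:
  "subst \<theta> (concat_inf \<tau> a b) = concat_inf \<tau> (subst \<theta> a) (subst \<theta> b)"
  by (simp add: concat_inf_def substs)

section \<open>Type inference and its stability under renaming and substitution\<close>

fun type_of :: "ty list \<Rightarrow> tm \<Rightarrow> ty option" where
  "type_of \<Gamma> (Var n) = (if n < length \<Gamma> then Some (\<Gamma> ! n) else None)"
| "type_of \<Gamma> (f \<cdot> a) = (case type_of \<Gamma> f of
     Some (\<rho> \<rightarrow>\<^sub>t \<eta>) \<Rightarrow> if type_of \<Gamma> a = Some \<rho> then Some \<eta> else None | _ \<Rightarrow> None)"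
| "type_of \<Gamma> (Lam \<rho> b) = map_option (\<lambda>\<eta>. \<rho> \<rightarrow>\<^sub>t \<eta>) (type_of (\<rho> # \<Gamma>) b)"
| "type_of \<Gamma> Zero = Some NatT"
| "type_of \<Gamma> Succ = Some (NatT \<rightarrow>\<^sub>t NatT)"
| "type_of \<Gamma> (Rec \<rho>) = Some (\<rho> \<rightarrow>\<^sub>t (NatT \<rightarrow>\<^sub>t \<rho> \<rightarrow>\<^sub>t \<rho>) \<rightarrow>\<^sub>t NatT \<rightarrow>\<^sub>t \<rho>)"
| "type_of \<Gamma> (Emp \<tau>) = Some (SeqT \<tau>)"
| "type_of \<Gamma> (Snoc \<tau>) = Some (SeqT \<tau> \<rightarrow>\<^sub>t \<tau> \<rightarrow>\<^sub>t SeqT \<tau>)"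
| "type_of \<Gamma> (Len \<tau>) = Some (SeqT \<tau> \<rightarrow>\<^sub>t NatT)"
| "type_of \<Gamma> (Hat \<tau>) = Some (SeqT \<tau> \<rightarrow>\<^sub>t NatT \<rightarrow>\<^sub>t \<tau>)"

text \<open>Abstractions and constants carry their types, so a term has at most one type in a
  context. As a rewrite rule this turns the typing premises of the calculus into
  computation.\<close>

lemma typed_iff [simp]: "typed \<Gamma> u \<rho> \<longleftrightarrow> type_of \<Gamma> u = Some \<rho>"
proof
  show "typed \<Gamma> u \<rho> \<Longrightarrow> type_of \<Gamma> u = Some \<rho>"
    by (induction rule: typed.induct) simp_all
  show "type_of \<Gamma> u = Some \<rho> \<Longrightarrow> typed \<Gamma> u \<rho>"
    by (induction u arbitrary: \<Gamma> \<rho>)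
      (fastforce intro: typed.intros split: option.splits ty.splits if_splits)+
qed

text \<open>The equation also covers ill-typed terms, so variables out of range must stay out of
  range; hence the equivalence in the first assumption. In return the shift rules below are
  unconditional rewrite rules.\<close>

lemma type_of_rename:
  assumes "\<And>n. r n < length \<Delta> \<longleftrightarrow> n < length \<Gamma>" "\<And>n. n < length \<Gamma> \<Longrightarrow> \<Delta> ! r n = \<Gamma> ! n"
  shows "type_of \<Delta> (rename r u) = type_of \<Gamma> u"
  using assms
proof (induction u arbitrary: r \<Gamma> \<Delta>)
  case (Lam \<rho> u)
  have "type_of (\<rho> # \<Delta>) (rename (up_ren r) u) = type_of (\<rho> # \<Gamma>) u"
    by (rule Lam.IH; case_tac n) (simp_all add: Lam.prems)
  then show ?case by simp
next
  case (App f a)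
  have "type_of \<Delta> (rename r f) = type_of \<Gamma> f" "type_of \<Delta> (rename r a) = type_of \<Gamma> a"
    using App by blast+
  then show ?case by (simp only: rename.simps type_of.simps)
qed simp_all

lemma type_of_shift [simp]:
  "type_of (\<rho>1 # \<Gamma>) (shift (Suc 0) u) = type_of \<Gamma> u"
  "type_of (\<rho>2 # \<rho>1 # \<Gamma>) (shift 2 u) = type_of \<Gamma> u"
  "type_of (\<rho>3 # \<rho>2 # \<rho>1 # \<Gamma>) (shift 3 u) = type_of \<Gamma> u"
  "type_of (\<rho>4 # \<rho>3 # \<rho>2 # \<rho>1 # \<Gamma>) (shift 4 u) = type_of \<Gamma> u"
  unfolding shift_def by (rule type_of_rename; simp add: eval_nat_numeral)+

text \<open>Types must still be computable after \<open>substs\<close> has replaced shifts by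
  substitutions.\<close>

lemma type_of_shift_subst [simp]:
  "type_of (\<rho>1 # \<Gamma>) (subst (\<lambda>n. Var (Suc n)) u) = type_of \<Gamma> u"
  "type_of (\<rho>2 # \<rho>1 # \<Gamma>) (subst (\<lambda>n. Var (Suc (Suc n))) u) = type_of \<Gamma> u"
  "type_of (\<rho>3 # \<rho>2 # \<rho>1 # \<Gamma>) (subst (\<lambda>n. Var (Suc (Suc (Suc n)))) u) = type_of \<Gamma> u"
  using type_of_shift by (simp_all add: substs)

lemma type_of_subst:
  assumes "type_of \<Gamma> u = Some \<rho>" "\<And>n. n < length \<Gamma> \<Longrightarrow> type_of \<Delta> (\<theta> n) = Some (\<Gamma> ! n)"
  shows "type_of \<Delta> (subst \<theta> u) = Some \<rho>"
  using assms
proof (induction u arbitrary: \<theta> \<Gamma> \<Delta> \<rho>)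
  case (Lam \<rho>' u)
  obtain \<eta> where \<eta>: "type_of (\<rho>' # \<Gamma>) u = Some \<eta>" "\<rho> = \<rho>' \<rightarrow>\<^sub>t \<eta>"
    using Lam.prems(1) by auto
  have "type_of (\<rho>' # \<Delta>) (subst (up_sub \<theta>) u) = Some \<eta>"
  proof (rule Lam.IH[OF \<eta>(1)])
    show "type_of (\<rho>' # \<Delta>) (up_sub \<theta> n) = Some ((\<rho>' # \<Gamma>) ! n)" if "n < length (\<rho>' # \<Gamma>)" for n
      using that Lam.prems(2) by (cases n) simp_all
  qed
  with \<eta> show ?case by simp
next
  case (App f a)
  obtain \<rho>' where "type_of \<Gamma> f = Some (\<rho>' \<rightarrow>\<^sub>t \<rho>)" "type_of \<Gamma> a = Some \<rho>'"
    using App.prems(1) by (auto split: option.splits ty.splits if_splits)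
  then have "type_of \<Delta> (subst \<theta> f) = Some (\<rho>' \<rightarrow>\<^sub>t \<rho>)" "type_of \<Delta> (subst \<theta> a) = Some \<rho>'"
    using App by blast+
  then show ?case by simp
qed (auto split: if_splits)

lemma wf_subst_fm:
  assumes "wf_fm \<Gamma> \<phi>" "\<And>n. n < length \<Gamma> \<Longrightarrow> type_of \<Delta> (\<theta> n) = Some (\<Gamma> ! n)"
  shows "wf_fm \<Delta> (subst_fm \<theta> \<phi>)"
proof -
  have up: "type_of (\<rho> # \<Delta>) (up_sub \<theta> n) = Some ((\<rho> # \<Gamma>) ! n)"
    if "n < length (\<rho> # \<Gamma>)" "\<And>n. n < length \<Gamma> \<Longrightarrow> type_of \<Delta> (\<theta> n) = Some (\<Gamma> ! n)"
    for \<rho> n \<theta> \<Gamma> \<Delta>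
    using that by (cases n) simp_all
  show ?thesis
    using assms
  proof (induction \<phi> arbitrary: \<theta> \<Gamma> \<Delta>)
    case (All \<rho> \<phi>)
    then show ?case using up by (metis subst_fm.simps(6) wf_fm.simps(6))
  next
    case (Ex \<rho> \<phi>)
    then show ?case using up by (metis subst_fm.simps(7) wf_fm.simps(7))
  qed (auto intro: type_of_subst)
qed

lemma type_of_ops [simp]:
  "type_of \<Gamma> a = Some NatT \<Longrightarrow> type_of \<Gamma> b = Some NatT \<Longrightarrow> type_of \<Gamma> (add a b) = Some NatT"
  "type_of \<Gamma> a = Some NatT \<Longrightarrow> type_of \<Gamma> (pred a) = Some NatT"
  "type_of \<Gamma> a = Some NatT \<Longrightarrow> type_of \<Gamma> b = Some NatT \<Longrightarrow> type_of \<Gamma> (monus a b) = Some NatT"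
  "type_of \<Gamma> c = Some NatT \<Longrightarrow> type_of \<Gamma> a = Some \<rho> \<Longrightarrow> type_of \<Gamma> b = Some \<rho> \<Longrightarrow>
    type_of \<Gamma> (if_zero \<rho> c a b) = Some \<rho>"
  "type_of \<Gamma> s = Some (SeqT \<tau>) \<Longrightarrow> type_of \<Gamma> u = Some (SeqT \<tau>) \<Longrightarrow>
    type_of \<Gamma> (concat_fin \<tau> s u) = Some (SeqT \<tau>)"
  "type_of \<Gamma> \<alpha> = Some (NatT \<rightarrow>\<^sub>t \<tau>) \<Longrightarrow> type_of \<Gamma> n = Some NatT \<Longrightarrow>
    type_of \<Gamma> (init_seg \<tau> \<alpha> n) = Some (SeqT \<tau>)"
  by (simp_all add: add_def pred_def monus_def if_zero_def concat_fin_def init_seg_def)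

lemma type_of_concat_inf [simp]:
  "type_of \<Gamma> s = Some (SeqT \<tau>) \<Longrightarrow> type_of \<Gamma> \<beta> = Some (NatT \<rightarrow>\<^sub>t \<tau>) \<Longrightarrow>
    type_of \<Gamma> (concat_inf \<tau> s \<beta>) = Some (NatT \<rightarrow>\<^sub>t \<tau>)"
  by (simp add: concat_inf_def)

lemma subst_closed:
  assumes "type_of [] u = Some \<rho>"
  shows "subst \<theta> u = u"
proof -
  \<comment> \<open>The body of an abstraction is no longer closed, so the induction runs over open
    terms whose free variables are fixed by \<open>\<theta>\<close>.\<close>
  have "\<forall>n<length \<Gamma>. \<theta> n = Var n \<Longrightarrow> type_of \<Gamma> u = Some \<rho> \<Longrightarrow> subst \<theta> u = u" for \<Gamma> \<rho> u \<theta>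
  proof (induction u arbitrary: \<Gamma> \<rho> \<theta>)
    case (Lam \<rho>' u)
    then obtain \<eta> where \<eta>: "type_of (\<rho>' # \<Gamma>) u = Some \<eta>" by auto
    have "\<forall>n<length (\<rho>' # \<Gamma>). up_sub \<theta> n = Var n"
      using Lam.prems(1) by (auto simp: up_sub_def shift_def split: nat.split)
    then show ?case using Lam.IH[OF _ \<eta>] by simp
  next
    case (App f a)
    then show ?case by (fastforce split: option.splits ty.splits if_splits)
  qed (auto split: if_splits)
  from this[of "[]" \<theta> u \<rho>] assms show ?thesis by simp
qed

section \<open>Equational reasoning\<close>

text \<open>Case distinctions enlarge the set of assumptions, and equations derived before the
  distinction must remain available in each case. The context stays the same.\<close>

lemma HA_mono: "HA \<Gamma> A \<phi> \<Longrightarrow> A \<subseteq> B \<Longrightarrow> HA \<Gamma> B \<phi>"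
proof (induction arbitrary: B rule: HA.induct)
  case (Assm \<phi> A \<Gamma>)
  then show ?case by (blast intro: HA.Assm)
next
  case (FlsE \<Gamma> A \<phi>)
  then show ?case by (blast intro: HA.FlsE)
next
  case (ConjI \<Gamma> A \<phi> \<psi>)
  then show ?case by (blast intro: HA.ConjI)
next
  case (ConjE1 \<Gamma> A \<phi> \<psi>)
  then show ?case by (blast intro: HA.ConjE1)
next
  case (ConjE2 \<Gamma> A \<phi> \<psi>)
  then show ?case by (blast intro: HA.ConjE2)
next
  case (DisjI1 \<Gamma> A \<phi> \<psi>)
  then show ?case by (blast intro: HA.DisjI1)
next
  case (DisjI2 \<Gamma> A \<psi> \<phi>)
  then show ?case by (blast intro: HA.DisjI2)
next
  case (DisjE \<Gamma> A \<phi> \<psi> \<chi>)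
  then show ?case by (meson HA.DisjE insert_mono)
next
  case (ImpI \<Gamma> \<phi> A \<psi>)
  then show ?case by (meson HA.ImpI insert_mono)
next
  case (ImpE \<Gamma> A \<phi> \<psi>)
  then show ?case by (blast intro: HA.ImpE)
next
  case (AllI \<rho> \<Gamma> A \<phi>)
  then show ?case by (meson HA.AllI image_mono)
next
  case (AllE \<Gamma> A \<rho> \<phi> u)
  then show ?case by (blast intro: HA.AllE)
next
  case (ExI \<rho> \<Gamma> \<phi> u A)
  then show ?case by (blast intro: HA.ExI)
next
  case (ExE \<Gamma> A \<rho> \<phi> \<chi>)
  then show ?case by (meson HA.ExE image_mono insert_mono)
next
  case (Leibniz \<rho> \<Gamma> \<phi> A u v)
  then show ?case by (blast intro: HA.Leibniz)
qed (auto intro: HA.intros)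

text \<open>Typing is bundled with derivability because reflexivity, the Leibniz rule and beta
  demand it; transitivity and congruence then have no typing premises of their own.\<close>

definition heq :: "ty list \<Rightarrow> fm set \<Rightarrow> ty \<Rightarrow> tm \<Rightarrow> tm \<Rightarrow> bool" where
  "heq \<Gamma> A \<rho> a b \<longleftrightarrow> typed \<Gamma> a \<rho> \<and> typed \<Gamma> b \<rho> \<and> HA \<Gamma> A (Eq \<rho> a b)"

lemma heq_type: "heq \<Gamma> A \<rho> a b \<Longrightarrow> type_of \<Gamma> a = Some \<rho> \<and> type_of \<Gamma> b = Some \<rho>"
  by (simp add: heq_def)

lemma heq_refl: "type_of \<Gamma> a = Some \<rho> \<Longrightarrow> heq \<Gamma> A \<rho> a a"
  by (simp add: heq_def HA.Refl)

lemma heq_sym: "heq \<Gamma> A \<rho> a b \<Longrightarrow> heq \<Gamma> A \<rho> b a"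
  using HA.Leibniz[of \<rho> \<Gamma> "Eq \<rho> (Var 0) (shift 1 a)" A a b] HA.Refl[of \<Gamma> a \<rho> A]
  by (simp add: heq_def substs)

lemma heq_trans [trans]: "heq \<Gamma> A \<rho> a b \<Longrightarrow> heq \<Gamma> A \<rho> b c \<Longrightarrow> heq \<Gamma> A \<rho> a c"
  using HA.Leibniz[of \<rho> \<Gamma> "Eq \<rho> (shift 1 a) (Var 0)" A b c]
  by (simp add: heq_def substs)

lemma heq_App:
  assumes "heq \<Gamma> A (\<rho> \<rightarrow>\<^sub>t \<eta>) f g" "heq \<Gamma> A \<rho> a b"
  shows "heq \<Gamma> A \<eta> (f \<cdot> a) (g \<cdot> b)"
proof -
  have "heq \<Gamma> A \<eta> (f \<cdot> a) (g \<cdot> a)"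
    using HA.Leibniz[of "\<rho> \<rightarrow>\<^sub>t \<eta>" \<Gamma> "Eq \<eta> (shift 1 (f \<cdot> a)) (Var 0 \<cdot> shift 1 a)" A f g]
      HA.Refl[of \<Gamma> "f \<cdot> a" \<eta> A] assms
    by (simp add: heq_def substs)
  also have "heq \<Gamma> A \<eta> (g \<cdot> a) (g \<cdot> b)"
    using HA.Leibniz[of \<rho> \<Gamma> "Eq \<eta> (shift 1 (g \<cdot> a)) (shift 1 g \<cdot> Var 0)" A a b]
      HA.Refl[of \<Gamma> "g \<cdot> a" \<eta> A] assms
    by (simp add: heq_def substs)
  finally show ?thesis .
qed

text \<open>The contractum is a separate variable \<open>c\<close>, so that callers can state it in
  readable form and leave the substitution to the simplifier.\<close>

lemma heq_Beta:
  assumes "type_of (\<rho> # \<Gamma>) b = Some \<eta>" "type_of \<Gamma> u = Some \<rho>" "subst (inst u 0) b = c"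
  shows "heq \<Gamma> A \<eta> (Lam \<rho> b \<cdot> u) c"
proof -
  have "type_of \<Gamma> (subst (inst u 0) b) = Some \<eta>"
  proof (rule type_of_subst[OF assms(1)])
    show "type_of \<Gamma> (inst u 0 n) = Some ((\<rho> # \<Gamma>) ! n)" if "n < length (\<rho> # \<Gamma>)" for n
      using that assms(2) by (cases n) simp_all
  qed
  then show ?thesis
    using HA.Beta[of \<rho> \<Gamma> b \<eta> u A] assms by (simp add: heq_def)
qed

lemma heq_Beta2:
  assumes "type_of (\<rho>2 # \<rho>1 # \<Gamma>) b = Some \<eta>" "type_of \<Gamma> u = Some \<rho>1" "type_of \<Gamma> v = Some \<rho>2"
    "subst (inst v 0) (subst (up_sub (inst u 0)) b) = c"
  shows "heq \<Gamma> A \<eta> (Lam \<rho>1 (Lam \<rho>2 b) \<cdot> u \<cdot> v) c"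
proof -
  have "heq \<Gamma> A (\<rho>2 \<rightarrow>\<^sub>t \<eta>) (Lam \<rho>1 (Lam \<rho>2 b) \<cdot> u) (Lam \<rho>2 (subst (up_sub (inst u 0)) b))"
    by (rule heq_Beta) (simp_all add: assms)
  note this[THEN heq_type] heq_App[OF this heq_refl[OF assms(3)]]
  moreover have "heq \<Gamma> A \<eta> (Lam \<rho>2 (subst (up_sub (inst u 0)) b) \<cdot> v) c"
    using calculation(1) assms by (intro heq_Beta) auto
  ultimately show ?thesis by (blast intro: heq_trans)
qed

lemma heq_mono: "heq \<Gamma> A \<rho> a b \<Longrightarrow> A \<subseteq> B \<Longrightarrow> heq \<Gamma> B \<rho> a b"
  by (auto simp: heq_def intro: HA_mono)

lemma heq_Assm:
  "Eq \<rho> a b \<in> A \<Longrightarrow> type_of \<Gamma> a = Some \<rho> \<Longrightarrow> type_of \<Gamma> b = Some \<rho> \<Longrightarrow> heq \<Gamma> A \<rho> a b"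
  by (simp add: heq_def HA.Assm)

lemma heq_ext:
  assumes "type_of \<Gamma> f = Some (\<rho> \<rightarrow>\<^sub>t \<eta>)" "type_of \<Gamma> g = Some (\<rho> \<rightarrow>\<^sub>t \<eta>)"
    "heq (\<rho> # \<Gamma>) (shift_fm ` A) \<eta> (shift 1 f \<cdot> Var 0) (shift 1 g \<cdot> Var 0)"
  shows "heq \<Gamma> A (\<rho> \<rightarrow>\<^sub>t \<eta>) f g"
  using assms HA.Ext[of \<Gamma> f \<rho> \<eta> g A] HA.AllI[of \<rho> \<Gamma> A] by (simp add: heq_def)

text \<open>The calculus has no congruence rule for abstractions. It is recovered from
  extensionality: a shifted abstraction applied to the fresh variable reduces to its own body. This
  is what allows recursive calls under the abstraction over \<open>x\<close> to be
  rewritten.\<close>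

lemma heq_Lam:
  assumes "heq (\<rho> # \<Gamma>) (shift_fm ` A) \<eta> b c"
  shows "heq \<Gamma> A (\<rho> \<rightarrow>\<^sub>t \<eta>) (Lam \<rho> b) (Lam \<rho> c)"
proof (rule heq_ext)
  \<comment> \<open>Shifting beneath the binder makes room for a second fresh variable, and
    instantiating the binder by that variable restores all indices.\<close>
  have unshift: "subst (inst (Var 0) 0) (subst (up_sub (\<lambda>n. Var (Suc n))) d) = d" for d
  proof -
    have "(\<lambda>n. subst (inst (Var 0) 0) (up_sub (\<lambda>n. Var (Suc n)) n)) = Var"
      by (rule ext) (simp add: up_sub_def substs split: nat.split)
    then show ?thesis by (simp add: subst_subst)
  qed
  have shift_Lam: "heq (\<rho> # \<Gamma>) (shift_fm ` A) \<eta> (shift 1 (Lam \<rho> d) \<cdot> Var 0) d"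
    if "type_of (\<rho> # \<Gamma>) d = Some \<eta>" for d
  proof -
    have "type_of (\<rho> # \<Gamma>) (shift 1 (Lam \<rho> d)) = Some (\<rho> \<rightarrow>\<^sub>t \<eta>)"
      using that by (simp del: type_of.simps(3) add: type_of.simps(3)[of \<Gamma>])
    with unshift[of d] show ?thesis
      by (auto simp add: shift_eq_subst intro!: heq_Beta)
  qed
  show "type_of \<Gamma> (Lam \<rho> b) = Some (\<rho> \<rightarrow>\<^sub>t \<eta>)" "type_of \<Gamma> (Lam \<rho> c) = Some (\<rho> \<rightarrow>\<^sub>t \<eta>)"
    using assms[THEN heq_type] by simp_all
  show "heq (\<rho> # \<Gamma>) (shift_fm ` A) \<eta> (shift 1 (Lam \<rho> b) \<cdot> Var 0) (shift 1 (Lam \<rho> c) \<cdot> Var 0)"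
    using assms[THEN heq_type] assms shift_Lam by (blast intro: heq_trans heq_sym)
qed

lemma heq_Rec_Zero:
  "type_of \<Gamma> a = Some \<rho> \<Longrightarrow> type_of \<Gamma> f = Some (NatT \<rightarrow>\<^sub>t \<rho> \<rightarrow>\<^sub>t \<rho>) \<Longrightarrow>
    heq \<Gamma> A \<rho> (Rec \<rho> \<cdot> a \<cdot> f \<cdot> Zero) a"
  by (simp add: heq_def HA.Rec_Zero)

lemma heq_Rec_Succ:
  assumes "type_of \<Gamma> a = Some \<rho>" "type_of (\<rho> # NatT # \<Gamma>) b = Some \<rho>" "type_of \<Gamma> m = Some NatT"
    "subst (inst (Rec \<rho> \<cdot> a \<cdot> Lam NatT (Lam \<rho> b) \<cdot> m) 0) (subst (up_sub (inst m 0)) b) = c"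
  shows "heq \<Gamma> A \<rho> (Rec \<rho> \<cdot> a \<cdot> Lam NatT (Lam \<rho> b) \<cdot> (Succ \<cdot> m)) c"
proof -
  let ?f = "Lam NatT (Lam \<rho> b)"
  have "heq \<Gamma> A \<rho> (Rec \<rho> \<cdot> a \<cdot> ?f \<cdot> (Succ \<cdot> m)) (?f \<cdot> m \<cdot> (Rec \<rho> \<cdot> a \<cdot> ?f \<cdot> m))"
    using assms by (simp add: heq_def HA.Rec_Succ)
  also have "heq \<Gamma> A \<rho> \<dots> c"
    by (rule heq_Beta2) (use assms in simp_all)
  finally show ?thesis .
qed

lemma heq_induct:
  assumes "type_of (NatT # \<Gamma>) a = Some \<rho>" "type_of (NatT # \<Gamma>) b = Some \<rho>"
    "type_of \<Gamma> n = Some NatT"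
    "heq \<Gamma> A \<rho> (subst (inst Zero 0) a) (subst (inst Zero 0) b)"
    "heq (NatT # \<Gamma>) (insert (Eq \<rho> a b) (shift_fm ` A)) \<rho>
      (subst (inst (Succ \<cdot> Var 0) 1) a) (subst (inst (Succ \<cdot> Var 0) 1) b)"
  shows "heq \<Gamma> A \<rho> (subst (inst n 0) a) (subst (inst n 0) b)"
proof -
  have "HA \<Gamma> A (All NatT (Eq \<rho> a b))"
    by (rule HA.Nat_induct) (use assms in \<open>auto simp: heq_def intro!: HA.AllI HA.ImpI\<close>)
  from HA.AllE[OF this, of n] have "HA \<Gamma> A (Eq \<rho> (subst (inst n 0) a) (subst (inst n 0) b))"
    using assms by simp
  moreover have "type_of \<Gamma> (subst (inst n 0) c) = Some \<rho>" if "type_of (NatT # \<Gamma>) c = Some \<rho>" for c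
    using heq_Beta[of NatT \<Gamma> c \<rho> n] that assms(3) heq_type by blast
  ultimately show ?thesis using assms by (simp add: heq_def)
qed

section \<open>Arithmetic\<close>

lemma heq_Rec:
  assumes "heq \<Gamma> A \<rho> a b" "heq \<Gamma> A NatT m n" "type_of \<Gamma> f = Some (NatT \<rightarrow>\<^sub>t \<rho> \<rightarrow>\<^sub>t \<rho>)"
  shows "heq \<Gamma> A \<rho> (Rec \<rho> \<cdot> a \<cdot> f \<cdot> m) (Rec \<rho> \<cdot> b \<cdot> f \<cdot> n)"
proof -
  have "heq \<Gamma> A (\<rho> \<rightarrow>\<^sub>t (NatT \<rightarrow>\<^sub>t \<rho> \<rightarrow>\<^sub>t \<rho>) \<rightarrow>\<^sub>t NatT \<rightarrow>\<^sub>t \<rho>) (Rec \<rho>) (Rec \<rho>)"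
    by (simp add: heq_refl)
  from heq_App[OF heq_App[OF heq_App[OF this assms(1)] heq_refl[OF assms(3)]] assms(2)]
  show ?thesis .
qed

text \<open>Inside a conditional only the tested number ever needs rewriting, so both branches stay
  fixed.\<close>

lemma heq_cong:
  "heq \<Gamma> A NatT a b \<Longrightarrow> heq \<Gamma> A NatT (Succ \<cdot> a) (Succ \<cdot> b)"
  "heq \<Gamma> A NatT a b \<Longrightarrow> heq \<Gamma> A NatT (pred a) (pred b)"
  "heq \<Gamma> A NatT a b \<Longrightarrow> heq \<Gamma> A NatT c d \<Longrightarrow> heq \<Gamma> A NatT (add a c) (add b d)"
  "heq \<Gamma> A NatT a b \<Longrightarrow> heq \<Gamma> A NatT c d \<Longrightarrow> heq \<Gamma> A NatT (monus a c) (monus b d)"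
  "heq \<Gamma> A NatT a b \<Longrightarrow> type_of \<Gamma> u = Some \<rho> \<Longrightarrow> type_of \<Gamma> v = Some \<rho> \<Longrightarrow>
    heq \<Gamma> A \<rho> (if_zero \<rho> a u v) (if_zero \<rho> b u v)"
proof -
  show "heq \<Gamma> A NatT a b \<Longrightarrow> heq \<Gamma> A NatT (Succ \<cdot> a) (Succ \<cdot> b)"
    by (rule heq_App, rule heq_refl) simp_all
qed (auto simp: add_def pred_def monus_def if_zero_def intro!: heq_Rec heq_refl)

lemma pred_Zero: "heq \<Gamma> A NatT (pred Zero) Zero"
  unfolding pred_def by (rule heq_Rec_Zero) simp_all

lemma pred_Succ: "type_of \<Gamma> a = Some NatT \<Longrightarrow> heq \<Gamma> A NatT (pred (Succ \<cdot> a)) a"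
  unfolding pred_def by (rule heq_Rec_Succ) (simp_all add: substs)

lemma add_Zero: "type_of \<Gamma> a = Some NatT \<Longrightarrow> heq \<Gamma> A NatT (add a Zero) a"
  unfolding add_def by (rule heq_Rec_Zero) simp_all

lemma add_Succ: "type_of \<Gamma> a = Some NatT \<Longrightarrow> type_of \<Gamma> b = Some NatT \<Longrightarrow>
    heq \<Gamma> A NatT (add a (Succ \<cdot> b)) (Succ \<cdot> add a b)"
  unfolding add_def by (rule heq_Rec_Succ) (simp_all add: substs)

lemma monus_Zero: "type_of \<Gamma> a = Some NatT \<Longrightarrow> heq \<Gamma> A NatT (monus a Zero) a"
  unfolding monus_def by (rule heq_Rec_Zero) simp_all

lemma monus_Succ: "type_of \<Gamma> a = Some NatT \<Longrightarrow> type_of \<Gamma> b = Some NatT \<Longrightarrow>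
    heq \<Gamma> A NatT (monus a (Succ \<cdot> b)) (pred (monus a b))"
  unfolding monus_def by (rule heq_Rec_Succ) (simp_all add: substs)

lemma if_zero_Zero:
  "type_of \<Gamma> a = Some \<rho> \<Longrightarrow> type_of \<Gamma> b = Some \<rho> \<Longrightarrow> heq \<Gamma> A \<rho> (if_zero \<rho> Zero a b) a"
  unfolding if_zero_def by (rule heq_Rec_Zero) simp_all

lemma if_zero_Succ:
  "type_of \<Gamma> a = Some \<rho> \<Longrightarrow> type_of \<Gamma> b = Some \<rho> \<Longrightarrow> type_of \<Gamma> c = Some NatT \<Longrightarrow>
    heq \<Gamma> A \<rho> (if_zero \<rho> (Succ \<cdot> c) a b) b"
  unfolding if_zero_def by (rule heq_Rec_Succ) (simp_all add: substs)

text \<open>\<open>add\<close> recurses on its second argument, so a successor in the first one can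
  only be moved out by induction.\<close>

lemma Succ_add:
  assumes [simp]: "type_of \<Gamma> a = Some NatT" "type_of \<Gamma> b = Some NatT"
  shows "heq \<Gamma> A NatT (add (Succ \<cdot> a) b) (Succ \<cdot> add a b)"
proof -
  let ?l = "add (Succ \<cdot> shift 1 a) (Var 0)" and ?r = "Succ \<cdot> add (shift 1 a) (Var 0)"
  let ?A = "insert (Eq NatT ?l ?r) (shift_fm ` A)"
  have "heq \<Gamma> A NatT (add (Succ \<cdot> a) Zero) (Succ \<cdot> add a Zero)"
    by (meson add_Zero heq_cong heq_trans heq_sym assms type_of.simps(2) typed_iff typed.intros)
  moreover have "heq (NatT # \<Gamma>) ?A NatT (add (Succ \<cdot> shift 1 a) (Succ \<cdot> Var 0))
    (Succ \<cdot> add (shift 1 a) (Succ \<cdot> Var 0))"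
  proof -
    have "heq (NatT # \<Gamma>) ?A NatT (add (Succ \<cdot> shift 1 a) (Succ \<cdot> Var 0)) (Succ \<cdot> ?l)"
      by (rule add_Succ) simp_all
    also have "heq (NatT # \<Gamma>) ?A NatT \<dots> (Succ \<cdot> ?r)"
      by (rule heq_cong, rule heq_Assm) simp_all
    also have "heq (NatT # \<Gamma>) ?A NatT \<dots> (Succ \<cdot> add (shift 1 a) (Succ \<cdot> Var 0))"
      by (rule heq_cong, rule heq_sym, rule add_Succ) simp_all
    finally show ?thesis .
  qed
  ultimately show ?thesis
    using heq_induct[of \<Gamma> ?l NatT ?r b A] by (simp add: substs)
qed

text \<open>The step is asked for over every set \<open>B\<close> that derives the induction
  hypothesis. The shifted assumption set then never has to be written out, and the hypothesis enters
  equational chains like any other equation.\<close>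

lemma heq_induct_Nat:
  assumes types: "type_of (NatT # \<Gamma>) a = Some \<rho>" "type_of (NatT # \<Gamma>) b = Some \<rho>"
    "type_of \<Gamma> n = Some NatT"
    and Zero: "heq \<Gamma> A \<rho> (subst (inst Zero 0) a) (subst (inst Zero 0) b)"
    and Succ: "\<And>B. heq (NatT # \<Gamma>) B \<rho> a b \<Longrightarrow> heq (NatT # \<Gamma>) B \<rho>
      (subst (inst (Succ \<cdot> Var 0) 1) a) (subst (inst (Succ \<cdot> Var 0) 1) b)"
    and "subst (inst n 0) a = a'" "subst (inst n 0) b = b'"
  shows "heq \<Gamma> A \<rho> a' b'"
proof -
  have "heq (NatT # \<Gamma>) (insert (Eq \<rho> a b) (shift_fm ` A)) \<rho> a b"
    by (rule heq_Assm) (simp_all add: types)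
  from heq_induct[OF types Zero Succ[OF this]] show ?thesis
    using assms by simp
qed

lemma Zero_add:
  assumes "type_of \<Gamma> a = Some NatT"
  shows "heq \<Gamma> A NatT (add Zero a) a"
proof (rule heq_induct_Nat[where a = "add Zero (Var 0)" and b = "Var 0"], goal_cases)
  case 4
  then show ?case by (simp add: add_Zero)
next
  case (5 B)
  have "heq (NatT # \<Gamma>) B NatT (add Zero (Succ \<cdot> Var 0)) (Succ \<cdot> add Zero (Var 0))"
    by (rule add_Succ) simp_all
  also have "heq (NatT # \<Gamma>) B NatT \<dots> (Succ \<cdot> Var 0)"
    by (rule heq_cong) (rule 5)
  finally show ?case by (simp add: substs)
qed (use assms in simp_all)

lemma Zero_monus:
  assumes "type_of \<Gamma> a = Some NatT"
  shows "heq \<Gamma> A NatT (monus Zero a) Zero"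
proof (rule heq_induct_Nat[where a = "monus Zero (Var 0)" and b = "Zero"], goal_cases)
  case 4
  then show ?case by (simp add: monus_Zero)
next
  case (5 B)
  have "heq (NatT # \<Gamma>) B NatT (monus Zero (Succ \<cdot> Var 0)) (pred (monus Zero (Var 0)))"
    by (rule monus_Succ) simp_all
  also have "heq (NatT # \<Gamma>) B NatT \<dots> (pred Zero)"
    by (rule heq_cong) (rule 5)
  also have "heq (NatT # \<Gamma>) B NatT \<dots> Zero"
    by (rule pred_Zero)
  finally show ?case by (simp add: substs)
qed (use assms in simp_all)

text \<open>Induction on the subtrahend, where \<open>monus\<close> recurses. Appending an entry to
  \<open>s\<close> raises the subtrahend of \<open>remaining\<close> by one; cancelling against its
  outer successor is how the count goes down.\<close>

lemma monus_Succ_Succ: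
  assumes [simp]: "type_of \<Gamma> a = Some NatT" "type_of \<Gamma> b = Some NatT"
  shows "heq \<Gamma> A NatT (monus (Succ \<cdot> a) (Succ \<cdot> b)) (monus a b)"
proof (rule heq_induct_Nat[where a = "monus (Succ \<cdot> shift 1 a) (Succ \<cdot> Var 0)"
      and b = "monus (shift 1 a) (Var 0)"], goal_cases)
  case 4
  have "heq \<Gamma> A NatT (monus (Succ \<cdot> a) (Succ \<cdot> Zero)) (pred (monus (Succ \<cdot> a) Zero))"
    by (rule monus_Succ) simp_all
  also have "heq \<Gamma> A NatT \<dots> (pred (Succ \<cdot> a))"
    by (rule heq_cong, rule monus_Zero) simp
  also have "heq \<Gamma> A NatT \<dots> a"
    by (rule pred_Succ) simp
  also have "heq \<Gamma> A NatT \<dots> (monus a Zero)"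
    by (rule heq_sym, rule monus_Zero) simp
  finally show ?case by (simp add: substs)
next
  case (5 B)
  have "heq (NatT # \<Gamma>) B NatT (monus (Succ \<cdot> shift 1 a) (Succ \<cdot> (Succ \<cdot> Var 0)))
      (pred (monus (Succ \<cdot> shift 1 a) (Succ \<cdot> Var 0)))"
    by (rule monus_Succ) simp_all
  also have "heq (NatT # \<Gamma>) B NatT \<dots> (pred (monus (shift 1 a) (Var 0)))"
    by (rule heq_cong) (rule 5)
  also have "heq (NatT # \<Gamma>) B NatT \<dots> (monus (shift 1 a) (Succ \<cdot> Var 0))"
    by (rule heq_sym, rule monus_Succ) simp_all
  finally show ?case by (simp add: substs)
qed (simp_all add: substs)

lemma add_monus:
  assumes [simp]: "type_of \<Gamma> a = Some NatT" "type_of \<Gamma> b = Some NatT"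
  shows "heq \<Gamma> A NatT (monus (add a b) a) b"
proof (rule heq_induct_Nat[where a = "monus (add (Var 0) (shift 1 b)) (Var 0)"
      and b = "shift 1 b"], goal_cases)
  case 4
  have "heq \<Gamma> A NatT (monus (add Zero b) Zero) (add Zero b)"
    by (rule monus_Zero) simp
  also have "heq \<Gamma> A NatT \<dots> b"
    by (rule Zero_add) simp
  finally show ?case by (simp add: substs)
next
  case (5 B)
  have "heq (NatT # \<Gamma>) B NatT (monus (add (Succ \<cdot> Var 0) (shift 1 b)) (Succ \<cdot> Var 0))
      (monus (Succ \<cdot> add (Var 0) (shift 1 b)) (Succ \<cdot> Var 0))"
    by (rule heq_cong(4), rule Succ_add; (rule heq_refl)?) simp_all
  also have "heq (NatT # \<Gamma>) B NatT \<dots> (monus (add (Var 0) (shift 1 b)) (Var 0))"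
    by (rule monus_Succ_Succ) simp_all
  also have "heq (NatT # \<Gamma>) B NatT \<dots> (shift 1 b)"
    by (rule 5)
  finally show ?case by (simp add: substs)
qed (simp_all add: substs)

lemma monus_add:
  assumes [simp]: "type_of \<Gamma> a = Some NatT" "type_of \<Gamma> b = Some NatT"
  shows "heq \<Gamma> A NatT (monus a (add a b)) Zero"
proof (rule heq_induct_Nat[where a = "monus (Var 0) (add (Var 0) (shift 1 b))"
      and b = "Zero"], goal_cases)
  case 4
  show ?case by (simp add: substs Zero_monus)
next
  case (5 B)
  have "heq (NatT # \<Gamma>) B NatT (monus (Succ \<cdot> Var 0) (add (Succ \<cdot> Var 0) (shift 1 b)))
      (monus (Succ \<cdot> Var 0) (Succ \<cdot> add (Var 0) (shift 1 b)))"
    by (rule heq_cong(4), rule heq_refl, simp, rule Succ_add) simp_all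
  also have "heq (NatT # \<Gamma>) B NatT \<dots> (monus (Var 0) (add (Var 0) (shift 1 b)))"
    by (rule monus_Succ_Succ) simp_all
  also have "heq (NatT # \<Gamma>) B NatT \<dots> Zero"
    by (rule 5)
  finally show ?case by (simp add: substs)
qed (simp_all add: substs)

text \<open>Naming the predecessor by the term \<open>pred n\<close> avoids an existential
  quantifier, so both cases stay in the context \<open>\<Gamma>\<close> and only the assumptions
  grow.\<close>

lemma heq_cases_Nat:
  assumes "type_of \<Gamma> n = Some NatT"
    and Zero: "\<And>B. A \<subseteq> B \<Longrightarrow> heq \<Gamma> B NatT n Zero \<Longrightarrow> heq \<Gamma> B \<rho> a b"
    and Succ: "\<And>B. A \<subseteq> B \<Longrightarrow> heq \<Gamma> B NatT n (Succ \<cdot> pred n) \<Longrightarrow> heq \<Gamma> B \<rho> a b"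
  shows "heq \<Gamma> A \<rho> a b"
proof -
  let ?\<phi> = "Eq NatT (Var 0) Zero \<^bold>\<or> Eq NatT (Var 0) (Succ \<cdot> pred (Var 0))"
  have "HA \<Gamma> A (All NatT ?\<phi>)"
  proof (rule HA.Nat_induct)
    show "HA \<Gamma> A (subst_fm (inst Zero 0) ?\<phi>)"
      by (simp add: HA.DisjI1 HA.Refl)
    let ?A = "insert ?\<phi> (shift_fm ` A)"
    have "heq (NatT # \<Gamma>) ?A NatT (Succ \<cdot> Var 0) (Succ \<cdot> pred (Succ \<cdot> Var 0))"
      by (rule heq_cong, rule heq_sym, rule pred_Succ) simp
    then show "HA \<Gamma> A (All NatT (?\<phi> \<^bold>\<longrightarrow> subst_fm (inst (Succ \<cdot> Var 0) 1) ?\<phi>))"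
      by (auto simp: heq_def intro!: HA.AllI HA.ImpI HA.DisjI2)
  qed
  from HA.AllE[OF this, of n] have
    cases: "HA \<Gamma> A (Eq NatT n Zero \<^bold>\<or> Eq NatT n (Succ \<cdot> pred n))"
    using assms(1) by simp
  have "heq \<Gamma> (insert (Eq NatT n Zero) A) \<rho> a b"
    using assms(1) by (intro Zero heq_Assm) auto
  moreover have "heq \<Gamma> (insert (Eq NatT n (Succ \<cdot> pred n)) A) \<rho> a b"
    using assms(1) by (intro Succ heq_Assm) auto
  ultimately show ?thesis
    using HA.DisjE[OF cases] by (simp add: heq_def)
qed

text \<open>Both sides are the maximum of \<open>a\<close> and \<open>n\<close>. If
  \<open>a - n\<close> is zero, this yields \<open>n = a + (n - a)\<close>, which is how a position
  beyond the end of a sequence is split.\<close>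

lemma add_monus_commute:
  assumes [simp]: "type_of \<Gamma> a = Some NatT" "type_of \<Gamma> n = Some NatT"
  shows "heq \<Gamma> A NatT (add a (monus n a)) (add n (monus a n))"
proof -
  \<comment> \<open>Quantified over the second argument, because the step from \<open>a\<close> to
    its successor uses the hypothesis at \<open>pred n\<close>.\<close>
  let ?\<phi> = "\<lambda>a. All NatT (Eq NatT (add (shift 1 a) (monus (Var 0) (shift 1 a)))
    (add (Var 0) (monus (shift 1 a) (Var 0))))"
  have elim: "heq \<Gamma> A NatT (add a (monus n a)) (add n (monus a n))"
    if "HA \<Gamma> A (?\<phi> a)" "type_of \<Gamma> a = Some NatT" "type_of \<Gamma> n = Some NatT" for \<Gamma> A a n
    using HA.AllE[OF that(1), of n] that(2,3) by (simp add: heq_def substs)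
  have "HA \<Gamma> A (All NatT (?\<phi> (Var 0)))"
  proof (rule HA.Nat_induct)
    let ?\<Gamma> = "NatT # \<Gamma>" and ?A = "shift_fm ` A"
    have "heq ?\<Gamma> ?A NatT (add Zero (monus (Var 0) Zero)) (monus (Var 0) Zero)"
      by (rule Zero_add) simp
    also have "heq ?\<Gamma> ?A NatT \<dots> (Var 0)"
      by (rule monus_Zero) simp
    also have "heq ?\<Gamma> ?A NatT \<dots> (add (Var 0) Zero)"
      by (rule heq_sym, rule add_Zero) simp
    also have "heq ?\<Gamma> ?A NatT \<dots> (add (Var 0) (monus Zero (Var 0)))"
      by (rule heq_cong, rule heq_refl, simp, rule heq_sym, rule Zero_monus) simp
    finally show "HA \<Gamma> A (subst_fm (inst Zero 0) (?\<phi> (Var 0)))"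
      by (auto simp: heq_def substs intro: HA.AllI)
  next
    let ?\<Gamma> = "NatT # NatT # \<Gamma>" and ?A = "shift_fm ` insert (?\<phi> (Var 0)) (shift_fm ` A)"
    let ?Sa = "Succ \<cdot> Var 1" and ?n = "Var 0" and ?p = "pred (Var 0)"
    have "heq ?\<Gamma> ?A NatT (add ?Sa (monus ?n ?Sa)) (add ?n (monus ?Sa ?n))"
    proof (rule heq_cases_Nat[where n = ?n])
      fix B assume n: "heq ?\<Gamma> B NatT ?n Zero"
      have "heq ?\<Gamma> B NatT (add ?Sa (monus ?n ?Sa)) (add ?Sa (monus Zero ?Sa))"
        by (intro heq_cong n heq_refl) simp_all
      also have "heq ?\<Gamma> B NatT \<dots> (add ?Sa Zero)"
        by (intro heq_cong(3) heq_refl Zero_monus) simp_all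
      also have "heq ?\<Gamma> B NatT \<dots> ?Sa"
        by (rule add_Zero) simp
      also have "heq ?\<Gamma> B NatT \<dots> (add Zero ?Sa)"
        by (rule heq_sym, rule Zero_add) simp
      also have "heq ?\<Gamma> B NatT \<dots> (add Zero (monus ?Sa Zero))"
        by (rule heq_cong, rule heq_refl, simp, rule heq_sym, rule monus_Zero) simp
      also have "heq ?\<Gamma> B NatT \<dots> (add ?n (monus ?Sa ?n))"
        by (rule heq_sym) (intro heq_cong n heq_refl; simp)
      finally show "heq ?\<Gamma> B NatT (add ?Sa (monus ?n ?Sa)) (add ?n (monus ?Sa ?n))" .
    next
      fix B assume AB: "?A \<subseteq> B" and n: "heq ?\<Gamma> B NatT ?n (Succ \<cdot> ?p)"
      have "?\<phi> (Var 1) \<in> B"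
        using AB by (auto simp: substs)
      then have IH: "heq ?\<Gamma> B NatT (add (Var 1) (monus ?p (Var 1))) (add ?p (monus (Var 1) ?p))"
        by (intro elim HA.Assm) (simp_all add: substs)
      have "heq ?\<Gamma> B NatT (add ?Sa (monus ?n ?Sa)) (add ?Sa (monus (Succ \<cdot> ?p) ?Sa))"
        by (intro heq_cong(3,4) n heq_refl) simp_all
      also have "heq ?\<Gamma> B NatT \<dots> (add ?Sa (monus ?p (Var 1)))"
        by (intro heq_cong(3) heq_refl monus_Succ_Succ) simp_all
      also have "heq ?\<Gamma> B NatT \<dots> (Succ \<cdot> add (Var 1) (monus ?p (Var 1)))"
        by (rule Succ_add) simp_all
      also have "heq ?\<Gamma> B NatT \<dots> (Succ \<cdot> add ?p (monus (Var 1) ?p))"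
        by (intro heq_cong IH)
      also have "heq ?\<Gamma> B NatT \<dots> (add (Succ \<cdot> ?p) (monus (Var 1) ?p))"
        by (rule heq_sym, rule Succ_add) simp_all
      also have "heq ?\<Gamma> B NatT \<dots> (add (Succ \<cdot> ?p) (monus ?Sa (Succ \<cdot> ?p)))"
        by (rule heq_cong, rule heq_refl, simp, rule heq_sym, rule monus_Succ_Succ) simp_all
      also have "heq ?\<Gamma> B NatT \<dots> (add ?n (monus ?Sa ?n))"
        by (rule heq_sym) (intro heq_cong(3,4) n heq_refl; simp)
      finally show "heq ?\<Gamma> B NatT (add ?Sa (monus ?n ?Sa)) (add ?n (monus ?Sa ?n))" .
    qed simp
    then show "HA \<Gamma> A (All NatT (?\<phi> (Var 0) \<^bold>\<longrightarrow> subst_fm (inst (Succ \<cdot> Var 0) 1) (?\<phi> (Var 0))))"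
      by (intro HA.AllI HA.ImpI) (simp_all add: heq_def substs HA.AllI)
  qed
  from HA.AllE[OF this, of a] have "HA \<Gamma> A (?\<phi> a)"
    by (simp add: substs)
  then show ?thesis by (intro elim) simp_all
qed

text \<open>A witness of the inequality writes \<open>b\<close> as \<open>Succ a + k\<close>, and
  the difference vanishes. With \<open>le_imp_monus\<close> this replaces the existential case
  conditions of Spector's recursion by equations for the step count.\<close>

lemma less_imp_monus:
  assumes [simp]: "type_of \<Gamma> a = Some NatT" "type_of \<Gamma> b = Some NatT"
    and "HA \<Gamma> A (less_fm a b)"
  shows "heq \<Gamma> A NatT (monus (Succ \<cdot> a) b) Zero"
proof -
  let ?\<Gamma> = "NatT # \<Gamma>" and ?a = "shift 1 a" and ?b = "shift 1 b"
  let ?A = "insert (Eq NatT (add (Succ \<cdot> ?a) (Var 0)) ?b) (shift_fm ` A)"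
  have "heq ?\<Gamma> ?A NatT (monus (Succ \<cdot> ?a) ?b) (monus (Succ \<cdot> ?a) (add (Succ \<cdot> ?a) (Var 0)))"
    by (rule heq_cong, rule heq_refl, simp, rule heq_sym, rule heq_Assm) simp_all
  also have "heq ?\<Gamma> ?A NatT \<dots> Zero"
    by (rule monus_add) simp_all
  finally have "HA \<Gamma> A (Eq NatT (monus (Succ \<cdot> a) b) Zero)"
    using assms(3) unfolding less_fm_def le_fm_def
    by (elim HA.ExE) (simp_all add: heq_def substs)
  then show ?thesis by (simp add: heq_def)
qed

text \<open>With a witness \<open>k\<close>, \<open>b = a + k\<close> and
  \<open>Succ b = a + Succ k\<close>, so both differences are computed by
  \<open>add_monus\<close>.\<close>

lemma le_imp_monus:
  assumes [simp]: "type_of \<Gamma> a = Some NatT" "type_of \<Gamma> b = Some NatT"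
    and "HA \<Gamma> A (le_fm a b)"
  shows "heq \<Gamma> A NatT (monus (Succ \<cdot> b) a) (Succ \<cdot> monus b a)"
proof -
  let ?\<Gamma> = "NatT # \<Gamma>" and ?a = "shift 1 a" and ?b = "shift 1 b"
  let ?A = "insert (Eq NatT (add ?a (Var 0)) ?b) (shift_fm ` A)"
  have b: "heq ?\<Gamma> ?A NatT ?b (add ?a (Var 0))"
    by (rule heq_sym, rule heq_Assm) simp_all
  have "heq ?\<Gamma> ?A NatT (monus (Succ \<cdot> ?b) ?a) (monus (Succ \<cdot> add ?a (Var 0)) ?a)"
    by (intro heq_cong(1,4) b heq_refl) simp
  also have "heq ?\<Gamma> ?A NatT \<dots> (monus (add ?a (Succ \<cdot> Var 0)) ?a)"
    by (rule heq_cong, rule heq_sym, rule add_Succ; (rule heq_refl)?) simp_all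
  also have "heq ?\<Gamma> ?A NatT \<dots> (Succ \<cdot> Var 0)"
    by (rule add_monus) simp_all
  also have "heq ?\<Gamma> ?A NatT \<dots> (Succ \<cdot> monus (add ?a (Var 0)) ?a)"
    by (rule heq_cong, rule heq_sym, rule add_monus) simp_all
  also have "heq ?\<Gamma> ?A NatT \<dots> (Succ \<cdot> monus ?b ?a)"
    by (rule heq_sym) (intro heq_cong(1,4) b heq_refl; simp)
  finally have "HA \<Gamma> A (Eq NatT (monus (Succ \<cdot> b) a) (Succ \<cdot> monus b a))"
    using assms(3) unfolding le_fm_def
    by (elim HA.ExE) (simp_all add: heq_def substs)
  then show ?thesis by (simp add: heq_def)
qed

section \<open>Sequences and predicates on them\<close>

text \<open>Positivity of \<open>|s| - n\<close> excludes \<open>n = |s|\<close>, since that would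
  equate \<open>Succ p\<close> with \<open>|s| - |s|\<close>, which is zero. The axiom for the
  entries other than the last one then applies.\<close>

lemma Hat_Snoc_below:
  assumes [simp]: "type_of \<Gamma> s = Some (SeqT \<tau>)" "type_of \<Gamma> x = Some \<tau>" "type_of \<Gamma> n = Some NatT"
    "type_of \<Gamma> p = Some NatT"
    and pos: "heq \<Gamma> A NatT (monus (Len \<tau> \<cdot> s) n) (Succ \<cdot> p)"
  shows "heq \<Gamma> A \<tau> (Hat \<tau> \<cdot> (Snoc \<tau> \<cdot> s \<cdot> x) \<cdot> n) (Hat \<tau> \<cdot> s \<cdot> n)"
proof -
  let ?l = "Len \<tau> \<cdot> s"
  let ?A = "insert (Eq NatT n ?l) A"
  have "heq \<Gamma> ?A NatT (Succ \<cdot> p) (monus ?l n)"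
    by (rule heq_sym, rule heq_mono[OF pos]) auto
  also have "heq \<Gamma> ?A NatT \<dots> (monus ?l ?l)"
    by (rule heq_cong, rule heq_refl, simp, rule heq_Assm) simp_all
  also have "heq \<Gamma> ?A NatT \<dots> (monus ?l (add ?l Zero))"
    by (rule heq_cong, rule heq_refl, simp, rule heq_sym, rule add_Zero) simp_all
  also have "heq \<Gamma> ?A NatT \<dots> Zero"
    by (rule monus_add) simp_all
  finally have "HA \<Gamma> ?A Fls"
    using HA.Succ_not_Zero[of \<Gamma> p ?A] by (auto simp: heq_def intro: HA.ImpE)
  then have "HA \<Gamma> A (\<^bold>\<not> Eq NatT n ?l)"
    by (intro HA.ImpI) simp_all
  with HA.Hat_Snoc_other[of \<Gamma> s \<tau> x n A] show ?thesis
    by (auto simp: heq_def intro: HA.ImpE)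
qed

text \<open>Taking the entries of \<open>u\<close> itself from position \<open>|s|\<close> on as the infinite tail shows that the extension
  of \<open>u\<close> by zeros has the form \<open>s * \<beta>\<close> without an induction on sequences.\<close>

definition tail_of :: "ty \<Rightarrow> tm \<Rightarrow> tm \<Rightarrow> tm" where
  "tail_of \<tau> s u = Lam NatT (Hat \<tau> \<cdot> shift 1 u \<cdot> add (Len \<tau> \<cdot> shift 1 s) (Var 0))"

lemma type_of_tail_of [simp]:
  "type_of \<Gamma> s = Some (SeqT \<tau>) \<Longrightarrow> type_of \<Gamma> u = Some (SeqT \<tau>) \<Longrightarrow>
    type_of \<Gamma> (tail_of \<tau> s u) = Some (NatT \<rightarrow>\<^sub>t \<tau>)"
  by (simp add: tail_of_def)

text \<open>The premise \<open>agree\<close> asks that \<open>u\<close> and \<open>s\<close>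
  coincide below the length of \<open>s\<close>; it is needed for \<open>u = s\<close> and for
  \<open>u = s * x\<close>. Position \<open>n\<close> lies below that length if
  \<open>|s| - n\<close> is a successor, which matches the case split inside
  \<open>concat_inf\<close>.\<close>

lemma Hat_eq_concat_inf:
  assumes [simp]: "type_of \<Gamma> s = Some (SeqT \<tau>)" "type_of \<Gamma> u = Some (SeqT \<tau>)"
    and agree: "\<And>B p. type_of (NatT # \<Gamma>) p = Some NatT \<Longrightarrow>
      heq (NatT # \<Gamma>) B NatT (monus (Len \<tau> \<cdot> shift 1 s) (Var 0)) (Succ \<cdot> p) \<Longrightarrow>
      heq (NatT # \<Gamma>) B \<tau> (Hat \<tau> \<cdot> shift 1 u \<cdot> Var 0) (Hat \<tau> \<cdot> shift 1 s \<cdot> Var 0)"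
  shows "heq \<Gamma> A (NatT \<rightarrow>\<^sub>t \<tau>) (Hat \<tau> \<cdot> u) (concat_inf \<tau> s (tail_of \<tau> s u))"
proof (rule heq_ext)
  let ?\<Gamma> = "NatT # \<Gamma>" and ?s = "shift 1 s" and ?u = "shift 1 u" and ?n = "Var 0"
  let ?l = "Len \<tau> \<cdot> ?s"
  let ?c = "monus ?l ?n" and ?b = "shift 1 (tail_of \<tau> s u) \<cdot> monus ?n ?l"
    and ?h = "Hat \<tau> \<cdot> ?s \<cdot> ?n"
  have "heq ?\<Gamma> (shift_fm ` A) \<tau> (Hat \<tau> \<cdot> ?u \<cdot> ?n) (if_zero \<tau> ?c ?b ?h)"
  proof (rule heq_cases_Nat[where n = ?c])
    fix B assume c: "heq ?\<Gamma> B NatT ?c Zero"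
    \<comment> \<open>Beyond the end of \<open>s\<close>, the tail is read at \<open>n - |s|\<close>
      and looks up \<open>u\<close> at \<open>|s| + (n - |s|)\<close>; this sum has to be identified
      with \<open>n\<close>.\<close>
    have "heq ?\<Gamma> B NatT ?n (add ?n Zero)"
      by (rule heq_sym, rule add_Zero) simp
    also have "heq ?\<Gamma> B NatT \<dots> (add ?n ?c)"
      by (rule heq_cong, rule heq_refl, simp, rule heq_sym, rule c)
    also have "heq ?\<Gamma> B NatT \<dots> (add ?l (monus ?n ?l))"
      by (rule heq_sym, rule add_monus_commute) simp_all
    finally have n: "heq ?\<Gamma> B NatT ?n (add ?l (monus ?n ?l))" .
    have "heq ?\<Gamma> B \<tau> (Hat \<tau> \<cdot> ?u \<cdot> ?n) (Hat \<tau> \<cdot> ?u \<cdot> add ?l (monus ?n ?l))"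
      by (rule heq_App, rule heq_refl, simp, rule n)
    also have "heq ?\<Gamma> B \<tau> \<dots> ?b"
      by (rule heq_sym) (auto simp: tail_of_def substs intro!: heq_Beta)
    also have "heq ?\<Gamma> B \<tau> \<dots> (if_zero \<tau> Zero ?b ?h)"
      by (rule heq_sym, rule if_zero_Zero) simp_all
    also have "heq ?\<Gamma> B \<tau> \<dots> (if_zero \<tau> ?c ?b ?h)"
      by (rule heq_cong, rule heq_sym, rule c) simp_all
    finally show "heq ?\<Gamma> B \<tau> (Hat \<tau> \<cdot> ?u \<cdot> ?n) (if_zero \<tau> ?c ?b ?h)" .
  next
    fix B assume c: "heq ?\<Gamma> B NatT ?c (Succ \<cdot> pred ?c)"
    have "heq ?\<Gamma> B \<tau> (Hat \<tau> \<cdot> ?u \<cdot> ?n) ?h"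
      by (rule agree[OF _ c]) simp
    also have "heq ?\<Gamma> B \<tau> \<dots> (if_zero \<tau> (Succ \<cdot> pred ?c) ?b ?h)"
      by (rule heq_sym, rule if_zero_Succ) simp_all
    also have "heq ?\<Gamma> B \<tau> \<dots> (if_zero \<tau> ?c ?b ?h)"
      by (rule heq_cong, rule heq_sym, rule c) simp_all
    finally show "heq ?\<Gamma> B \<tau> (Hat \<tau> \<cdot> ?u \<cdot> ?n) (if_zero \<tau> ?c ?b ?h)" .
  qed simp
  also have "heq ?\<Gamma> (shift_fm ` A) \<tau> \<dots> (shift 1 (concat_inf \<tau> s (tail_of \<tau> s u)) \<cdot> ?n)"
    by (rule heq_sym, simp add: concat_inf_def substs, rule heq_Beta)
      (simp_all add: tail_of_def substs)
  finally show "heq ?\<Gamma> (shift_fm ` A) \<tau> (shift 1 (Hat \<tau> \<cdot> u) \<cdot> ?n)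
      (shift 1 (concat_inf \<tau> s (tail_of \<tau> s u)) \<cdot> ?n)"
    by (simp add: substs)
qed simp_all

text \<open>Monotonicity of a bar speaks of concatenation, bar recursion of appending one entry;
  this equation links the two.\<close>

lemma concat_fin_singleton:
  assumes [simp]: "type_of \<Gamma> s = Some (SeqT \<tau>)" "type_of \<Gamma> x = Some \<tau>"
  shows "heq \<Gamma> A (SeqT \<tau>) (concat_fin \<tau> s (Snoc \<tau> \<cdot> Emp \<tau> \<cdot> x)) (Snoc \<tau> \<cdot> s \<cdot> x)"
proof -
  let ?u = "Snoc \<tau> \<cdot> Emp \<tau> \<cdot> x"
  let ?b = "Snoc \<tau> \<cdot> Var 0 \<cdot> (Hat \<tau> \<cdot> shift 2 ?u \<cdot> Var 1)"
  let ?f = "Lam NatT (Lam (SeqT \<tau>) ?b)"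
  \<comment> \<open>The length is kept as the successor of
    \<open>Len \<tau> \<cdot> Emp \<tau>\<close>: the recursor unfolds once, and it reads the entry
    exactly at the position for which \<open>Hat_Snoc_last\<close> gives \<open>x\<close>.\<close>
  have "heq \<Gamma> A NatT (Len \<tau> \<cdot> ?u) (Succ \<cdot> (Len \<tau> \<cdot> Emp \<tau>))"
    by (simp add: heq_def HA.Len_Snoc)
  then have "heq \<Gamma> A (SeqT \<tau>) (concat_fin \<tau> s ?u)
      (Rec (SeqT \<tau>) \<cdot> s \<cdot> ?f \<cdot> (Succ \<cdot> (Len \<tau> \<cdot> Emp \<tau>)))"
    unfolding concat_fin_def by (intro heq_Rec heq_refl) simp_all
  also have "heq \<Gamma> A (SeqT \<tau>) \<dots>
      (Snoc \<tau> \<cdot> (Rec (SeqT \<tau>) \<cdot> s \<cdot> ?f \<cdot> (Len \<tau> \<cdot> Emp \<tau>)) \<cdot> (Hat \<tau> \<cdot> ?u \<cdot> (Len \<tau> \<cdot> Emp \<tau>)))"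
    by (rule heq_Rec_Succ) (simp_all add: substs)
  also have "heq \<Gamma> A (SeqT \<tau>) \<dots> (Snoc \<tau> \<cdot> s \<cdot> x)"
  proof (rule heq_App, rule heq_App, rule heq_refl)
    have "heq \<Gamma> A NatT (Len \<tau> \<cdot> Emp \<tau>) Zero"
      by (simp add: heq_def HA.Len_Emp)
    then have "heq \<Gamma> A (SeqT \<tau>) (Rec (SeqT \<tau>) \<cdot> s \<cdot> ?f \<cdot> (Len \<tau> \<cdot> Emp \<tau>))
        (Rec (SeqT \<tau>) \<cdot> s \<cdot> ?f \<cdot> Zero)"
      by (intro heq_Rec heq_refl) simp_all
    also have "heq \<Gamma> A (SeqT \<tau>) \<dots> s"
      by (rule heq_Rec_Zero) simp_all
    finally show "heq \<Gamma> A (SeqT \<tau>) (Rec (SeqT \<tau>) \<cdot> s \<cdot> ?f \<cdot> (Len \<tau> \<cdot> Emp \<tau>)) s" .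
    show "heq \<Gamma> A \<tau> (Hat \<tau> \<cdot> ?u \<cdot> (Len \<tau> \<cdot> Emp \<tau>)) x"
      by (simp add: heq_def HA.Hat_Snoc_last)
  qed simp
  finally show ?thesis .
qed

section \<open>Instances of a predicate with parameters\<close>

lemma at_eq: "at S k u = subst_fm (case_nat u (\<lambda>n. Var (n + k))) S"
  by (simp add: at_def inst_def)

text \<open>\<open>S\<close> is an arbitrary formula, so substitution does not compute through it.
  Instances of \<open>S\<close> are brought to this one form and compared by their argument and
  their renumbering of parameters.\<close>

lemma subst_fm_case_nat:
  "subst_fm \<theta> (subst_fm (case_nat u \<psi>) S) = subst_fm (case_nat (subst \<theta> u) (\<lambda>n. subst \<theta> (\<psi> n))) S"
proof -
  have "(\<lambda>n. subst \<theta> (case_nat u \<psi> n)) = case_nat (subst \<theta> u) (\<lambda>n. subst \<theta> (\<psi> n))"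
    by (rule ext) (simp split: nat.split)
  then show ?thesis by (simp add: subst_fm_subst_fm)
qed

lemmas at_substs = at_eq subst_fm_case_nat shift_fm_def shift_eq_subst subst_subst eval_nat_numeral

lemma wf_at:
  assumes "wf_fm (SeqT \<tau> # \<Gamma>) S" "type_of (\<Delta> @ \<Gamma>) u = Some (SeqT \<tau>)" "k = length \<Delta>"
  shows "wf_fm (\<Delta> @ \<Gamma>) (at S k u)"
  unfolding at_def
proof (rule wf_subst_fm[OF assms(1)])
  show "type_of (\<Delta> @ \<Gamma>) (inst u k n) = Some ((SeqT \<tau> # \<Gamma>) ! n)" if "n < length (SeqT \<tau> # \<Gamma>)" for n
    using that assms by (cases n) (simp_all add: nth_append)
qed

lemma wf_at_simps:
  assumes "wf_fm (SeqT \<tau> # \<Gamma>) S"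
  shows "type_of \<Gamma> u = Some (SeqT \<tau>) \<Longrightarrow> wf_fm \<Gamma> (at S 0 u)"
    "type_of (\<rho>1 # \<Gamma>) u = Some (SeqT \<tau>) \<Longrightarrow> wf_fm (\<rho>1 # \<Gamma>) (at S (Suc 0) u)"
    "type_of (\<rho>2 # \<rho>1 # \<Gamma>) u = Some (SeqT \<tau>) \<Longrightarrow> wf_fm (\<rho>2 # \<rho>1 # \<Gamma>) (at S 2 u)"
    "type_of (\<rho>3 # \<rho>2 # \<rho>1 # \<Gamma>) u = Some (SeqT \<tau>) \<Longrightarrow> wf_fm (\<rho>3 # \<rho>2 # \<rho>1 # \<Gamma>) (at S 3 u)"
  using wf_at[OF assms, of "[]"] wf_at[OF assms, of "[\<rho>1]"] wf_at[OF assms, of "[\<rho>2, \<rho>1]"]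
    wf_at[OF assms, of "[\<rho>3, \<rho>2, \<rho>1]"] by (simp_all add: eval_nat_numeral)

lemma wf_weaken_pred:
  assumes "wf_fm (SeqT \<tau> # \<Gamma>) S"
  shows "wf_fm (SeqT \<tau> # \<rho> # \<Gamma>) (weaken_pred S)"
  using wf_at[OF assms, of "[SeqT \<tau>, \<rho>]" "Var 0"] by (simp add: weaken_pred_def eval_nat_numeral)

lemma HA_cut: "HA \<Gamma> A \<phi> \<Longrightarrow> wf_fm \<Gamma> \<phi> \<Longrightarrow> HA \<Gamma> (insert \<phi> A) \<psi> \<Longrightarrow> HA \<Gamma> A \<psi>"
  by (blast intro: HA.ImpI HA.ImpE)

section \<open>Bar recursion for a fixed functional\<close>

locale secured_functional =
  fixes \<tau> \<sigma> :: ty and t :: tm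
  assumes typed_t: "typed [] t ((NatT \<rightarrow>\<^sub>t \<tau>) \<rightarrow>\<^sub>t NatT)"
begin

abbreviation "G_ty \<equiv> SeqT \<tau> \<rightarrow>\<^sub>t \<sigma>"
abbreviation "H_ty \<equiv> SeqT \<tau> \<rightarrow>\<^sub>t (\<tau> \<rightarrow>\<^sub>t \<sigma>) \<rightarrow>\<^sub>t \<sigma>"

declare br_ty_def [simp]

lemma subst_t [simp]: "subst \<theta> t = t"
  using typed_t by (simp add: subst_closed)

lemma shift_t [simp]: "shift k t = t"
  by (simp add: shift_eq_subst)

lemma type_of_t [simp]: "type_of \<Gamma> t = Some ((NatT \<rightarrow>\<^sub>t \<tau>) \<rightarrow>\<^sub>t NatT)"
  using type_of_subst[of "[]" t _ \<Gamma> Var] typed_t by simp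

text \<open>The successor reflects the strict inequality in Spector's stopping condition: the value
  is zero just when \<open>t\<close> at the extension of \<open>s\<close> is below the length of
  \<open>s\<close>.\<close>

definition remaining :: "tm \<Rightarrow> tm" where
  "remaining s = monus (Succ \<cdot> (t \<cdot> (Hat \<tau> \<cdot> s))) (Len \<tau> \<cdot> s)"

text \<open>The \<open>n\<close>-fold unfolding of Spector's recursion, ending in \<open>G\<close>.
  The recursive call is made at \<open>s * x\<close> and not at \<open>s\<close>, so the recursor
  must produce functions of the sequence; this is why its type is \<open>G_ty\<close>.\<close>

definition iter :: "tm \<Rightarrow> tm \<Rightarrow> tm \<Rightarrow> tm" where
  "iter G H n = Rec G_ty \<cdot> G
     \<cdot> Lam NatT (Lam G_ty (Lam (SeqT \<tau>)
         (shift 3 H \<cdot> Var 0 \<cdot> Lam \<tau> (Var 2 \<cdot> (Snoc \<tau> \<cdot> Var 1 \<cdot> Var 0)))))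
     \<cdot> n"

text \<open>The number of iterations is computed afresh from the sequence at which the given
  recursor stops, so the place of the bar need not be known.\<close>

definition stop_fun :: "tm \<Rightarrow> tm \<Rightarrow> tm" where
  "stop_fun G H = Lam (SeqT \<tau>) (iter (shift 1 G) (shift 1 H) (remaining (Var 0)) \<cdot> Var 0)"

text \<open>Outside the bar Spector's recursion may already have to stop; the test detects this from
  \<open>t\<close> alone and then ignores the recursive calls.\<close>

definition step_fun :: "tm \<Rightarrow> tm \<Rightarrow> tm" where
  "step_fun G H = Lam (SeqT \<tau>) (Lam (\<tau> \<rightarrow>\<^sub>t \<sigma>)
     (if_zero \<sigma> (remaining (Var 1)) (shift 2 G \<cdot> Var 1) (shift 2 H \<cdot> Var 1 \<cdot> Var 0)))"

definition \<Phi> :: tm where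
  "\<Phi> = Lam (br_ty \<tau> \<sigma>) (Lam G_ty (Lam H_ty
     (Var 2 \<cdot> stop_fun (Var 1) (Var 0) \<cdot> step_fun (Var 1) (Var 0))))"

lemma subst_funs [simp]:
  "subst \<theta> (remaining s) = remaining (subst \<theta> s)"
  "subst \<theta> (iter G H n) = iter (subst \<theta> G) (subst \<theta> H) (subst \<theta> n)"
  "subst \<theta> (stop_fun G H) = stop_fun (subst \<theta> G) (subst \<theta> H)"
  "subst \<theta> (step_fun G H) = step_fun (subst \<theta> G) (subst \<theta> H)"
proof -
  show 1: "subst \<theta> (remaining s) = remaining (subst \<theta> s)" for \<theta> s
    by (simp add: remaining_def)
  show 2: "subst \<theta> (iter G H n) = iter (subst \<theta> G) (subst \<theta> H) (subst \<theta> n)" for \<theta> G H n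
    by (simp add: iter_def substs)
  show "subst \<theta> (stop_fun G H) = stop_fun (subst \<theta> G) (subst \<theta> H)"
    by (simp add: stop_fun_def 1 2 substs)
  show "subst \<theta> (step_fun G H) = step_fun (subst \<theta> G) (subst \<theta> H)"
    by (simp add: step_fun_def 1 substs)
qed

lemma type_of_remaining [simp]:
  "type_of \<Gamma> s = Some (SeqT \<tau>) \<Longrightarrow> type_of \<Gamma> (remaining s) = Some NatT"
  by (simp add: remaining_def)

lemma type_of_funs [simp]:
  assumes "type_of \<Gamma> G = Some G_ty" "type_of \<Gamma> H = Some H_ty"
  shows "type_of \<Gamma> n = Some NatT \<Longrightarrow> type_of \<Gamma> (iter G H n) = Some G_ty"
    "type_of \<Gamma> (stop_fun G H) = Some G_ty"
    "type_of \<Gamma> (step_fun G H) = Some H_ty"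
  using assms by (simp_all add: iter_def stop_fun_def step_fun_def)

lemma type_of_\<Phi> [simp]: "type_of \<Gamma> \<Phi> = Some (br_ty \<tau> \<sigma> \<rightarrow>\<^sub>t br_ty \<tau> \<sigma>)"
  by (simp add: \<Phi>_def br_ty_def)

lemma subst_\<Phi> [simp]: "subst \<theta> \<Phi> = \<Phi>"
  by (rule subst_closed[of _ "br_ty \<tau> \<sigma> \<rightarrow>\<^sub>t br_ty \<tau> \<sigma>"]) simp

text \<open>Besides the recursors of \<open>t\<close>, only those at \<open>NatT\<close>,
  \<open>\<sigma>\<close> and \<open>G_ty\<close> occur, and \<open>G_ty\<close> has the largest
  level of the three.\<close>

lemma in_T_\<Phi>:
  assumes "in_T i t" "level G_ty \<le> i"
  shows "in_T i \<Phi>"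
  using assms
  by (simp add: \<Phi>_def stop_fun_def step_fun_def iter_def remaining_def monus_def pred_def if_zero_def
      shift_def eval_nat_numeral)

lemma iter_Zero:
  assumes [simp]: "type_of \<Gamma> G = Some G_ty" "type_of \<Gamma> H = Some H_ty" "type_of \<Gamma> s = Some (SeqT \<tau>)"
  shows "heq \<Gamma> A \<sigma> (iter G H Zero \<cdot> s) (G \<cdot> s)"
  unfolding iter_def by (rule heq_App, rule heq_Rec_Zero; (rule heq_refl)?) simp_all

lemma iter_Succ:
  assumes [simp]: "type_of \<Gamma> G = Some G_ty" "type_of \<Gamma> H = Some H_ty" "type_of \<Gamma> s = Some (SeqT \<tau>)"
    "type_of \<Gamma> n = Some NatT"
  shows "heq \<Gamma> A \<sigma> (iter G H (Succ \<cdot> n) \<cdot> s)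
    (H \<cdot> s \<cdot> Lam \<tau> (shift 1 (iter G H n) \<cdot> (Snoc \<tau> \<cdot> shift 1 s \<cdot> Var 0)))"
proof -
  let ?b = "shift 1 H \<cdot> Var 0 \<cdot> Lam \<tau> (shift 2 (iter G H n) \<cdot> (Snoc \<tau> \<cdot> Var 1 \<cdot> Var 0))"
  have "heq \<Gamma> A G_ty (iter G H (Succ \<cdot> n)) (Lam (SeqT \<tau>) ?b)"
    unfolding iter_def by (rule heq_Rec_Succ) (simp_all add: substs)
  then have "heq \<Gamma> A \<sigma> (iter G H (Succ \<cdot> n) \<cdot> s) (Lam (SeqT \<tau>) ?b \<cdot> s)"
    by (rule heq_App) (simp add: heq_refl)
  also have "heq \<Gamma> A \<sigma> \<dots> (H \<cdot> s \<cdot> Lam \<tau> (shift 1 (iter G H n) \<cdot> (Snoc \<tau> \<cdot> shift 1 s \<cdot> Var 0)))"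
    by (rule heq_Beta) (simp_all, simp_all add: substs)
  finally show ?thesis .
qed

lemma iter_cong:
  assumes "type_of \<Gamma> G = Some G_ty" "type_of \<Gamma> H = Some H_ty" "type_of \<Gamma> s = Some (SeqT \<tau>)"
    "heq \<Gamma> A NatT m n"
  shows "heq \<Gamma> A \<sigma> (iter G H m \<cdot> s) (iter G H n \<cdot> s)"
  unfolding iter_def by (rule heq_App, rule heq_Rec) (use assms in \<open>simp_all add: heq_refl\<close>)

text \<open>Stated without the sequence argument, so that it can also be applied under the
  abstraction over \<open>x\<close>.\<close>

lemma \<Phi>_eq:
  assumes [simp]: "type_of \<Gamma> \<Delta> = Some (br_ty \<tau> \<sigma>)" "type_of \<Gamma> G = Some G_ty"
    "type_of \<Gamma> H = Some H_ty"
  shows "heq \<Gamma> A G_ty (\<Phi> \<cdot> \<Delta> \<cdot> G \<cdot> H) (\<Delta> \<cdot> stop_fun G H \<cdot> step_fun G H)"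
proof -
  let ?b = "shift 2 \<Delta> \<cdot> stop_fun (Var 1) (Var 0) \<cdot> step_fun (Var 1) (Var 0)"
  have "heq \<Gamma> A (br_ty \<tau> \<sigma>) (\<Phi> \<cdot> \<Delta>) (Lam G_ty (Lam H_ty ?b))"
    unfolding \<Phi>_def by (rule heq_Beta) (simp_all, simp_all add: substs)
  then have "heq \<Gamma> A G_ty (\<Phi> \<cdot> \<Delta> \<cdot> G \<cdot> H) (Lam G_ty (Lam H_ty ?b) \<cdot> G \<cdot> H)"
    by (intro heq_App[where \<rho> = H_ty] heq_App[where \<rho> = G_ty] heq_refl) simp_all
  also have "heq \<Gamma> A G_ty \<dots> (\<Delta> \<cdot> stop_fun G H \<cdot> step_fun G H)"
    by (rule heq_Beta2) (simp_all, simp_all add: substs)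
  finally show ?thesis .
qed

text \<open>Membership in \<open>A\<close> rather than derivability makes these hypotheses stable under passing to an
  extended context, so no weakening theorem for derivations is needed.\<close>

definition bar_hyps :: "ty list \<Rightarrow> fm set \<Rightarrow> fm \<Rightarrow> tm \<Rightarrow> bool" where
  "bar_hyps \<Gamma> A S \<Delta> \<longleftrightarrow> wf_fm (SeqT \<tau> # \<Gamma>) S \<and> type_of \<Gamma> \<Delta> = Some (br_ty \<tau> \<sigma>) \<and>
     is_bar \<tau> S \<in> A \<and> secures \<tau> S t \<in> A \<and> GBR \<tau> \<sigma> S \<Delta> \<in> A"

lemma bar_hyps_mono: "bar_hyps \<Gamma> A S \<Delta> \<Longrightarrow> A \<subseteq> B \<Longrightarrow> bar_hyps \<Gamma> B S \<Delta>"
  by (auto simp: bar_hyps_def)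

lemma wf_bar_fms [simp]:
  assumes "wf_fm (SeqT \<tau> # \<Gamma>) S"
  shows "wf_fm \<Gamma> (is_bar \<tau> S)" "wf_fm \<Gamma> (secures \<tau> S t)"
    "type_of \<Gamma> \<Delta> = Some (br_ty \<tau> \<sigma>) \<Longrightarrow> wf_fm \<Gamma> (GBR \<tau> \<sigma> S \<Delta>)"
  by (simp_all add: is_bar_def secures_def GBR_def bar_rec_def br_ty_def wf_at_simps[OF assms])

text \<open>A new variable only turns the parameter \<open>S\<close> into its weakening and shifts
  \<open>\<Delta>\<close>; the shape of the three hypotheses is preserved.\<close>

lemma shift_fm_bar_fms [simp]:
  "shift_fm (is_bar \<tau> S) = is_bar \<tau> (weaken_pred S)"
  "shift_fm (secures \<tau> S t) = secures \<tau> (weaken_pred S) t"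
  "shift_fm (GBR \<tau> \<sigma> S \<Delta>) = GBR \<tau> \<sigma> (weaken_pred S) (shift 1 \<Delta>)"
  by (simp_all add: is_bar_def secures_def GBR_def bar_rec_def weaken_pred_def at_substs)

lemma bar_hyps_shift:
  "bar_hyps \<Gamma> A S \<Delta> \<Longrightarrow> bar_hyps (\<rho> # \<Gamma>) (shift_fm ` A) (weaken_pred S) (shift 1 \<Delta>)"
  using imageI[of "is_bar \<tau> S" A shift_fm] imageI[of "secures \<tau> S t" A shift_fm]
    imageI[of "GBR \<tau> \<sigma> S \<Delta>" A shift_fm]
  by (simp add: bar_hyps_def wf_weaken_pred)

section \<open>What the hypotheses yield at a single sequence\<close>

context
  fixes \<Gamma> :: "ty list" and A :: "fm set" and S :: fm and \<Delta> s :: tm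
  assumes hyps: "bar_hyps \<Gamma> A S \<Delta>" and s [simp]: "type_of \<Gamma> s = Some (SeqT \<tau>)"
begin

lemma wf_S: "wf_fm (SeqT \<tau> # \<Gamma>) S"
  and type_of_\<Delta>: "type_of \<Gamma> \<Delta> = Some (br_ty \<tau> \<sigma>)"
  using hyps by (simp_all add: bar_hyps_def)

lemma type_of_\<Delta>': "type_of \<Gamma> \<Delta> = Some (G_ty \<rightarrow>\<^sub>t H_ty \<rightarrow>\<^sub>t G_ty)"
  using type_of_\<Delta> by (simp add: br_ty_def)

lemma bar_decidable: "HA \<Gamma> A (at S 0 s \<^bold>\<or> \<^bold>\<not> at S 0 s)"
proof -
  have "HA \<Gamma> A (is_bar \<tau> S)"
    using hyps by (intro HA.Assm) (simp_all add: bar_hyps_def)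
  then have "HA \<Gamma> A (All (SeqT \<tau>) (at S 1 (Var 0) \<^bold>\<or> \<^bold>\<not> at S 1 (Var 0)))"
    unfolding is_bar_def by (rule HA.ConjE1)
  from HA.AllE[OF this, of s] show ?thesis
    by (simp add: at_substs)
qed

text \<open>Monotonicity is used with the one-element sequence of \<open>x\<close>. The
  concatenation is only provably equal to the appended sequence, so membership is transported by the
  Leibniz rule.\<close>

lemma bar_Snoc:
  assumes "HA \<Gamma> A (at S 0 s)" and x [simp]: "type_of \<Gamma> x = Some \<tau>"
  shows "HA \<Gamma> A (at S 0 (Snoc \<tau> \<cdot> s \<cdot> x))"
proof -
  let ?u = "Snoc \<tau> \<cdot> Emp \<tau> \<cdot> x"
  have "HA \<Gamma> A (is_bar \<tau> S)"
    using hyps by (intro HA.Assm) (simp_all add: bar_hyps_def)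
  then have "HA \<Gamma> A (All (SeqT \<tau>) (All (SeqT \<tau>)
      (at S 2 (Var 1) \<^bold>\<longrightarrow> at S 2 (concat_fin \<tau> (Var 1) (Var 0)))))"
    unfolding is_bar_def by (blast intro: HA.ConjE2)
  from HA.AllE[OF this, of s] have "HA \<Gamma> A (All (SeqT \<tau>)
      (at S 1 (shift 1 s) \<^bold>\<longrightarrow> at S 1 (concat_fin \<tau> (shift 1 s) (Var 0))))"
    by (simp add: at_substs)
  from HA.AllE[OF this, of ?u] have "HA \<Gamma> A (at S 0 s \<^bold>\<longrightarrow> at S 0 (concat_fin \<tau> s ?u))"
    by (simp add: at_substs)
  then have "HA \<Gamma> A (at S 0 (concat_fin \<tau> s ?u))"
    using assms(1) by (rule HA.ImpE)
  then have "HA \<Gamma> A (subst_fm (inst (concat_fin \<tau> s ?u) 0) S)"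
    by (simp add: at_def)
  with HA.Leibniz[OF wf_S, of A "concat_fin \<tau> s ?u" "Snoc \<tau> \<cdot> s \<cdot> x"]
    concat_fin_singleton[of \<Gamma> s \<tau> x A]
  show ?thesis by (simp add: heq_def at_def)
qed

lemma secured_concat_inf:
  assumes "HA \<Gamma> A (at S 0 s)"
    "type_of \<Gamma> \<beta> = Some (NatT \<rightarrow>\<^sub>t \<tau>)" "type_of \<Gamma> \<gamma> = Some (NatT \<rightarrow>\<^sub>t \<tau>)"
  shows "heq \<Gamma> A NatT (t \<cdot> concat_inf \<tau> s \<beta>) (t \<cdot> concat_inf \<tau> s \<gamma>)"
proof -
  have "HA \<Gamma> A (secures \<tau> S t)"
    using hyps by (intro HA.Assm) (simp_all add: bar_hyps_def)
  from HA.AllE[OF this[unfolded secures_def], of s]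
  have "HA \<Gamma> A (at S 0 s \<^bold>\<longrightarrow> All (NatT \<rightarrow>\<^sub>t \<tau>) (All (NatT \<rightarrow>\<^sub>t \<tau>)
      (Eq NatT (t \<cdot> concat_inf \<tau> (shift 2 s) (Var 1)) (t \<cdot> concat_inf \<tau> (shift 2 s) (Var 0)))))"
    by (simp add: at_substs)
  from HA.AllE[OF HA.ImpE[OF this assms(1)], of \<beta>]
  have "HA \<Gamma> A (All (NatT \<rightarrow>\<^sub>t \<tau>) (Eq NatT (t \<cdot> concat_inf \<tau> (shift 1 s) (shift 1 \<beta>))
      (t \<cdot> concat_inf \<tau> (shift 1 s) (Var 0))))"
    using assms(2) by (simp add: substs)
  from HA.AllE[OF this, of \<gamma>] show ?thesis
    using assms(2,3) by (simp add: heq_def substs)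
qed

text \<open>The zero extensions of \<open>s * x\<close> and of \<open>s\<close> both have the form
  \<open>s * \<beta>\<close>, with tails read off from \<open>s * x\<close> and from
  \<open>s\<close>; \<open>t\<close> does not distinguish such continuations of a secured
  sequence.\<close>

lemma secured_Snoc:
  assumes S: "HA \<Gamma> A (at S 0 s)" and x [simp]: "type_of \<Gamma> x = Some \<tau>"
  shows "heq \<Gamma> A NatT (t \<cdot> (Hat \<tau> \<cdot> (Snoc \<tau> \<cdot> s \<cdot> x))) (t \<cdot> (Hat \<tau> \<cdot> s))"
proof -
  let ?u = "Snoc \<tau> \<cdot> s \<cdot> x"
  have "heq \<Gamma> A (NatT \<rightarrow>\<^sub>t \<tau>) (Hat \<tau> \<cdot> ?u) (concat_inf \<tau> s (tail_of \<tau> s ?u))"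
  proof (rule Hat_eq_concat_inf)
    fix B p
    assume "type_of (NatT # \<Gamma>) p = Some NatT"
      "heq (NatT # \<Gamma>) B NatT (monus (Len \<tau> \<cdot> shift 1 s) (Var 0)) (Succ \<cdot> p)"
    then have "heq (NatT # \<Gamma>) B \<tau> (Hat \<tau> \<cdot> (Snoc \<tau> \<cdot> shift 1 s \<cdot> shift 1 x) \<cdot> Var 0)
        (Hat \<tau> \<cdot> shift 1 s \<cdot> Var 0)"
      by (intro Hat_Snoc_below) simp_all
    then show "heq (NatT # \<Gamma>) B \<tau> (Hat \<tau> \<cdot> shift 1 ?u \<cdot> Var 0) (Hat \<tau> \<cdot> shift 1 s \<cdot> Var 0)"
      by (simp add: shift_def)
  qed simp_all
  then have "heq \<Gamma> A NatT (t \<cdot> (Hat \<tau> \<cdot> ?u)) (t \<cdot> concat_inf \<tau> s (tail_of \<tau> s ?u))"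
    by (intro heq_App[where \<rho> = "NatT \<rightarrow>\<^sub>t \<tau>"] heq_refl) simp_all
  also have "heq \<Gamma> A NatT \<dots> (t \<cdot> concat_inf \<tau> s (tail_of \<tau> s s))"
    by (rule secured_concat_inf[OF S]) simp_all
  also have "heq \<Gamma> A NatT \<dots> (t \<cdot> (Hat \<tau> \<cdot> s))"
    by (rule heq_sym, rule heq_App, rule heq_refl, simp, rule Hat_eq_concat_inf)
      (simp_all add: heq_refl)
  finally show ?thesis .
qed

lemma GBR_instance:
  assumes [simp]: "type_of \<Gamma> G = Some G_ty" "type_of \<Gamma> H = Some H_ty"
  shows "HA \<Gamma> A (at S 0 s) \<Longrightarrow> heq \<Gamma> A \<sigma> (\<Delta> \<cdot> G \<cdot> H \<cdot> s) (G \<cdot> s)"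
  "HA \<Gamma> A (\<^bold>\<not> at S 0 s) \<Longrightarrow> heq \<Gamma> A \<sigma> (\<Delta> \<cdot> G \<cdot> H \<cdot> s)
    (H \<cdot> s \<cdot> Lam \<tau> (shift 1 (\<Delta> \<cdot> G \<cdot> H) \<cdot> (Snoc \<tau> \<cdot> shift 1 s \<cdot> Var 0)))"
proof -
  note type_of_\<Delta>' [simp]
  have "HA \<Gamma> A (GBR \<tau> \<sigma> S \<Delta>)"
    using hyps by (intro HA.Assm) (simp_all add: bar_hyps_def)
  note HA.AllE[OF this[unfolded GBR_def bar_rec_def], of G, simplified, simplified at_substs, simplified]
  from HA.AllE[OF this, of H]
  have "HA \<Gamma> A (All (SeqT \<tau>) (
      (at S 1 (Var 0) \<^bold>\<longrightarrow> Eq \<sigma> (shift 1 (\<Delta> \<cdot> G \<cdot> H) \<cdot> Var 0) (shift 1 G \<cdot> Var 0)) \<^bold>\<and>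
      (\<^bold>\<not> at S 1 (Var 0) \<^bold>\<longrightarrow> Eq \<sigma> (shift 1 (\<Delta> \<cdot> G \<cdot> H) \<cdot> Var 0)
        (shift 1 H \<cdot> Var 0 \<cdot> Lam \<tau> (shift 2 (\<Delta> \<cdot> G \<cdot> H) \<cdot> (Snoc \<tau> \<cdot> Var 1 \<cdot> Var 0))))))"
    by (simp add: at_substs)
  from HA.AllE[OF this, of s]
  have eqs: "HA \<Gamma> A ((at S 0 s \<^bold>\<longrightarrow> Eq \<sigma> (\<Delta> \<cdot> G \<cdot> H \<cdot> s) (G \<cdot> s)) \<^bold>\<and>
      (\<^bold>\<not> at S 0 s \<^bold>\<longrightarrow> Eq \<sigma> (\<Delta> \<cdot> G \<cdot> H \<cdot> s)
        (H \<cdot> s \<cdot> Lam \<tau> (shift 1 (\<Delta> \<cdot> G \<cdot> H) \<cdot> (Snoc \<tau> \<cdot> shift 1 s \<cdot> Var 0)))))"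
    by (simp add: at_substs)
  show "HA \<Gamma> A (at S 0 s) \<Longrightarrow> heq \<Gamma> A \<sigma> (\<Delta> \<cdot> G \<cdot> H \<cdot> s) (G \<cdot> s)"
    using HA.ImpE[OF HA.ConjE1[OF eqs]] by (simp add: heq_def)
  have "type_of (\<tau> # \<Gamma>) (shift 1 (\<Delta> \<cdot> G \<cdot> H)) = Some G_ty"
    by simp
  then show "HA \<Gamma> A (\<^bold>\<not> at S 0 s) \<Longrightarrow> heq \<Gamma> A \<sigma> (\<Delta> \<cdot> G \<cdot> H \<cdot> s)
    (H \<cdot> s \<cdot> Lam \<tau> (shift 1 (\<Delta> \<cdot> G \<cdot> H) \<cdot> (Snoc \<tau> \<cdot> shift 1 s \<cdot> Var 0)))"
    using HA.ImpE[OF HA.ConjE2[OF eqs]] by (simp add: heq_def)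
qed

text \<open>The value of \<open>t\<close> is unchanged and the length grows by one. The result is
  written as a difference rather than with \<open>pred\<close>, which is the form in which
  \<open>le_imp_monus\<close> names the predecessor of \<open>remaining s\<close>.\<close>

lemma remaining_Snoc:
  assumes S: "HA \<Gamma> A (at S 0 s)" and x [simp]: "type_of \<Gamma> x = Some \<tau>"
  shows "heq \<Gamma> A NatT (remaining (Snoc \<tau> \<cdot> s \<cdot> x)) (monus (t \<cdot> (Hat \<tau> \<cdot> s)) (Len \<tau> \<cdot> s))"
proof -
  have "heq \<Gamma> A NatT (remaining (Snoc \<tau> \<cdot> s \<cdot> x))
      (monus (Succ \<cdot> (t \<cdot> (Hat \<tau> \<cdot> s))) (Succ \<cdot> (Len \<tau> \<cdot> s)))"
    unfolding remaining_def
    by (intro heq_cong(1,4) secured_Snoc S x) (simp add: heq_def HA.Len_Snoc)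
  also have "heq \<Gamma> A NatT \<dots> (monus (t \<cdot> (Hat \<tau> \<cdot> s)) (Len \<tau> \<cdot> s))"
    by (rule monus_Succ_Succ) simp_all
  finally show ?thesis .
qed

end

section \<open>Values of the constructed recursor on either side of the bar\<close>

lemma \<Phi>_inside:
  assumes hyps: "bar_hyps \<Gamma> A S \<Delta>"
    and types [simp]: "type_of \<Gamma> G = Some G_ty" "type_of \<Gamma> H = Some H_ty"
      "type_of \<Gamma> s = Some (SeqT \<tau>)"
    and S: "HA \<Gamma> A (at S 0 s)"
  shows "heq \<Gamma> A \<sigma> (\<Phi> \<cdot> \<Delta> \<cdot> G \<cdot> H \<cdot> s) (iter G H (remaining s) \<cdot> s)"
proof -
  have "heq \<Gamma> A \<sigma> (\<Phi> \<cdot> \<Delta> \<cdot> G \<cdot> H \<cdot> s) (\<Delta> \<cdot> stop_fun G H \<cdot> step_fun G H \<cdot> s)"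
    using type_of_\<Delta>[OF hyps types(3)]
    by (intro heq_App[where \<rho> = "SeqT \<tau>"] \<Phi>_eq heq_refl) simp_all
  also have "heq \<Gamma> A \<sigma> \<dots> (stop_fun G H \<cdot> s)"
    by (rule GBR_instance(1)[OF hyps _ _ _ S]) simp_all
  also have "heq \<Gamma> A \<sigma> \<dots> (iter G H (remaining s) \<cdot> s)"
    unfolding stop_fun_def by (rule heq_Beta) (simp_all, simp_all add: substs)
  finally show ?thesis .
qed

text \<open>The given recursor passes its own calls at \<open>s * x\<close> to the step function,
  and by \<open>\<Phi>_eq\<close> these are calls of \<open>\<Phi>\<close>. It does not matter
  whether \<open>s * x\<close> has entered the bar.\<close>

lemma \<Phi>_outside:
  assumes hyps: "bar_hyps \<Gamma> A S \<Delta>"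
    and types [simp]: "type_of \<Gamma> G = Some G_ty" "type_of \<Gamma> H = Some H_ty"
      "type_of \<Gamma> s = Some (SeqT \<tau>)"
    and S: "HA \<Gamma> A (\<^bold>\<not> at S 0 s)"
  shows "heq \<Gamma> A \<sigma> (\<Phi> \<cdot> \<Delta> \<cdot> G \<cdot> H \<cdot> s) (if_zero \<sigma> (remaining s) (G \<cdot> s)
    (H \<cdot> s \<cdot> Lam \<tau> (shift 1 (\<Phi> \<cdot> \<Delta> \<cdot> G \<cdot> H) \<cdot> (Snoc \<tau> \<cdot> shift 1 s \<cdot> Var 0))))"
proof -
  note type_of_\<Delta>'[OF hyps types(3), simp]
  have \<Delta>: "type_of \<Gamma> \<Delta> = Some (br_ty \<tau> \<sigma>)"
    by (rule type_of_\<Delta>[OF hyps types(3)])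
  let ?\<Delta> = "\<Delta> \<cdot> stop_fun G H \<cdot> step_fun G H" and ?s = "Snoc \<tau> \<cdot> shift 1 s \<cdot> Var 0"
  let ?f = "Lam \<tau> (shift 1 ?\<Delta> \<cdot> ?s)" and ?g = "Lam \<tau> (shift 1 (\<Phi> \<cdot> \<Delta> \<cdot> G \<cdot> H) \<cdot> ?s)"
  have "heq (\<tau> # \<Gamma>) (shift_fm ` A) G_ty
      (\<Phi> \<cdot> shift 1 \<Delta> \<cdot> shift 1 G \<cdot> shift 1 H)
      (shift 1 \<Delta> \<cdot> stop_fun (shift 1 G) (shift 1 H) \<cdot> step_fun (shift 1 G) (shift 1 H))"
    by (rule \<Phi>_eq) (simp_all add: \<Delta>)
  then have \<Phi>_shift: "heq (\<tau> # \<Gamma>) (shift_fm ` A) G_ty (shift 1 (\<Phi> \<cdot> \<Delta> \<cdot> G \<cdot> H)) (shift 1 ?\<Delta>)"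
    by (simp add: substs)
  have fg: "heq \<Gamma> A (\<tau> \<rightarrow>\<^sub>t \<sigma>) ?f ?g"
    by (rule heq_Lam, rule heq_App, rule heq_sym, rule \<Phi>_shift, rule heq_refl) simp
  have "heq \<Gamma> A \<sigma> (\<Phi> \<cdot> \<Delta> \<cdot> G \<cdot> H \<cdot> s) (?\<Delta> \<cdot> s)"
    using \<Delta> by (intro heq_App[where \<rho> = "SeqT \<tau>"] \<Phi>_eq heq_refl) simp_all
  also have "heq \<Gamma> A \<sigma> \<dots> (step_fun G H \<cdot> s \<cdot> ?f)"
    by (rule GBR_instance(2)[OF hyps _ _ _ S]) simp_all
  also have "heq \<Gamma> A \<sigma> \<dots> (step_fun G H \<cdot> s \<cdot> ?g)"
    by (rule heq_App[OF _ fg], rule heq_refl) simp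
  also have "heq \<Gamma> A \<sigma> \<dots> (if_zero \<sigma> (remaining s) (G \<cdot> s) (H \<cdot> s \<cdot> ?g))"
    using fg[THEN heq_type]
    unfolding step_fun_def by (intro heq_Beta2) (simp_all, simp_all add: substs)
  finally show ?thesis .
qed

text \<open>In the first case the instance of \<open>S\<close> is supplied as a member of
  \<open>B\<close> besides being derivable, because membership can be carried into the context
  extended by \<open>x\<close>.\<close>

lemma heq_bar_cases:
  assumes hyps: "bar_hyps \<Gamma> A S \<Delta>"
    and s: "type_of \<Gamma> s = Some (SeqT \<tau>)"
    and inside: "\<And>B. A \<subseteq> B \<Longrightarrow> bar_hyps \<Gamma> B S \<Delta> \<Longrightarrow> at S 0 s \<in> B \<Longrightarrow> HA \<Gamma> B (at S 0 s) \<Longrightarrow>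
      heq \<Gamma> B \<rho> a b"
    and outside: "\<And>B. A \<subseteq> B \<Longrightarrow> bar_hyps \<Gamma> B S \<Delta> \<Longrightarrow> HA \<Gamma> B (\<^bold>\<not> at S 0 s) \<Longrightarrow> heq \<Gamma> B \<rho> a b"
  shows "heq \<Gamma> A \<rho> a b"
proof -
  have wf: "wf_fm \<Gamma> (at S 0 s)"
    using hyps s by (simp add: bar_hyps_def wf_at_simps(1)[where \<tau> = \<tau>])
  have "heq \<Gamma> (insert (at S 0 s) A) \<rho> a b"
    by (rule inside) (use hyps wf in \<open>auto simp: bar_hyps_def intro: HA.Assm\<close>)
  moreover have "heq \<Gamma> (insert (\<^bold>\<not> at S 0 s) A) \<rho> a b"
    by (rule outside) (use hyps wf in \<open>auto simp: bar_hyps_def intro: HA.Assm\<close>)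
  moreover have "HA \<Gamma> A (at S 0 s \<^bold>\<or> \<^bold>\<not> at S 0 s)"
    using hyps s by (rule bar_decidable)
  ultimately show ?thesis
    by (auto simp: heq_def intro: HA.DisjE)
qed

section \<open>Spector's two equations\<close>

lemma \<Phi>_stop:
  assumes hyps: "bar_hyps \<Gamma> A S \<Delta>"
    and types [simp]: "type_of \<Gamma> G = Some G_ty" "type_of \<Gamma> H = Some H_ty"
      "type_of \<Gamma> s = Some (SeqT \<tau>)"
    and stop: "HA \<Gamma> A (less_fm (t \<cdot> (Hat \<tau> \<cdot> s)) (Len \<tau> \<cdot> s))"
  shows "heq \<Gamma> A \<sigma> (\<Phi> \<cdot> \<Delta> \<cdot> G \<cdot> H \<cdot> s) (G \<cdot> s)"
proof (rule heq_bar_cases[OF hyps types(3)])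
  \<comment> \<open>A count of zero settles both cases: the iteration inside the bar has no steps,
    and the conditional outside takes its first branch.\<close>
  have zero: "heq \<Gamma> A NatT (remaining s) Zero"
    unfolding remaining_def using stop by (intro less_imp_monus) simp_all
  {
    fix B assume B: "A \<subseteq> B" "bar_hyps \<Gamma> B S \<Delta>" "HA \<Gamma> B (at S 0 s)"
    have "heq \<Gamma> B \<sigma> (\<Phi> \<cdot> \<Delta> \<cdot> G \<cdot> H \<cdot> s) (iter G H (remaining s) \<cdot> s)"
      by (rule \<Phi>_inside[OF B(2) types B(3)])
    also have "heq \<Gamma> B \<sigma> \<dots> (iter G H Zero \<cdot> s)"
      by (rule iter_cong[OF types heq_mono[OF zero B(1)]])
    also have "heq \<Gamma> B \<sigma> \<dots> (G \<cdot> s)"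
      by (rule iter_Zero) simp_all
    finally show "heq \<Gamma> B \<sigma> (\<Phi> \<cdot> \<Delta> \<cdot> G \<cdot> H \<cdot> s) (G \<cdot> s)" .
  next
    fix B assume B: "A \<subseteq> B" "bar_hyps \<Gamma> B S \<Delta>" "HA \<Gamma> B (\<^bold>\<not> at S 0 s)"
    note type_of_\<Delta>'[OF hyps types(3), simp] type_of_\<Delta>[OF hyps types(3), simp]
    let ?b = "H \<cdot> s \<cdot> Lam \<tau> (shift 1 (\<Phi> \<cdot> \<Delta> \<cdot> G \<cdot> H) \<cdot> (Snoc \<tau> \<cdot> shift 1 s \<cdot> Var 0))"
    have b: "type_of \<Gamma> ?b = Some \<sigma>"
      by (simp add: br_ty_def)
    have "heq \<Gamma> B \<sigma> (\<Phi> \<cdot> \<Delta> \<cdot> G \<cdot> H \<cdot> s) (if_zero \<sigma> (remaining s) (G \<cdot> s) ?b)"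
      by (rule \<Phi>_outside[OF B(2) types B(3)])
    also have "heq \<Gamma> B \<sigma> \<dots> (if_zero \<sigma> Zero (G \<cdot> s) ?b)"
      by (rule heq_cong(5)[OF heq_mono[OF zero B(1)] _ b]) simp
    also have "heq \<Gamma> B \<sigma> \<dots> (G \<cdot> s)"
      by (rule if_zero_Zero[OF _ b]) simp
    finally show "heq \<Gamma> B \<sigma> (\<Phi> \<cdot> \<Delta> \<cdot> G \<cdot> H \<cdot> s) (G \<cdot> s)" .
  }
qed

text \<open>The count is a successor. Outside the bar the conditional takes its second branch,
  already the right-hand side. Inside, the iteration unfolds once, and its remaining
  \<open>?j\<close> steps at \<open>s * x\<close> agree with \<open>\<Phi>\<close> there, since
  \<open>s * x\<close> is again in the bar with count \<open>?j\<close>.\<close>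

lemma \<Phi>_continue:
  assumes hyps: "bar_hyps \<Gamma> A S \<Delta>"
    and types [simp]: "type_of \<Gamma> G = Some G_ty" "type_of \<Gamma> H = Some H_ty"
      "type_of \<Gamma> s = Some (SeqT \<tau>)"
    and continue: "HA \<Gamma> A (le_fm (Len \<tau> \<cdot> s) (t \<cdot> (Hat \<tau> \<cdot> s)))"
  shows "heq \<Gamma> A \<sigma> (\<Phi> \<cdot> \<Delta> \<cdot> G \<cdot> H \<cdot> s)
    (H \<cdot> s \<cdot> Lam \<tau> (shift 1 (\<Phi> \<cdot> \<Delta> \<cdot> G \<cdot> H) \<cdot> (Snoc \<tau> \<cdot> shift 1 s \<cdot> Var 0)))"
    (is "heq \<Gamma> A \<sigma> ?l (H \<cdot> s \<cdot> Lam \<tau> (?\<Phi> \<cdot> ?s))")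
proof (rule heq_bar_cases[OF hyps types(3)])
  note type_of_\<Delta>'[OF hyps types(3), simp] type_of_\<Delta>[OF hyps types(3), simp]
  let ?j = "monus (t \<cdot> (Hat \<tau> \<cdot> s)) (Len \<tau> \<cdot> s)"
  have Succ: "heq \<Gamma> A NatT (remaining s) (Succ \<cdot> ?j)"
    unfolding remaining_def using continue by (intro le_imp_monus) simp_all
  {
    fix B assume B: "A \<subseteq> B" "bar_hyps \<Gamma> B S \<Delta>" "at S 0 s \<in> B" "HA \<Gamma> B (at S 0 s)"
    let ?B = "shift_fm ` B" and ?G = "shift 1 G" and ?H = "shift 1 H"
    note hyps' = bar_hyps_shift[OF B(2), of \<tau>]
    have S: "HA (\<tau> # \<Gamma>) ?B (at (weaken_pred S) 0 (shift 1 s))"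
    proof (rule HA.Assm)
      show "at (weaken_pred S) 0 (shift 1 s) \<in> ?B"
        using imageI[OF B(3), of shift_fm] by (simp add: weaken_pred_def at_substs)
      show "wf_fm (\<tau> # \<Gamma>) (at (weaken_pred S) 0 (shift 1 s))"
        using hyps' by (simp add: bar_hyps_def wf_at_simps(1)[where \<tau> = \<tau>])
    qed
    \<comment> \<open>Monotonicity is applied under the abstraction, to the fresh variable in place
      of \<open>x\<close>.\<close>
    have S': "HA (\<tau> # \<Gamma>) ?B (at (weaken_pred S) 0 ?s)"
      by (rule bar_Snoc[OF hyps' _ S]) simp_all
    have "heq (\<tau> # \<Gamma>) ?B \<sigma> (\<Phi> \<cdot> shift 1 \<Delta> \<cdot> ?G \<cdot> ?H \<cdot> ?s) (iter ?G ?H (remaining ?s) \<cdot> ?s)"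
      by (rule \<Phi>_inside[OF hyps' _ _ _ S']) simp_all
    also have "heq (\<tau> # \<Gamma>) ?B \<sigma> \<dots> (iter ?G ?H (monus (t \<cdot> (Hat \<tau> \<cdot> shift 1 s)) (Len \<tau> \<cdot> shift 1 s)) \<cdot> ?s)"
      by (rule iter_cong, simp, simp, simp, rule remaining_Snoc[OF hyps' _ S]) simp_all
    finally have "heq (\<tau> # \<Gamma>) ?B \<sigma> (?\<Phi> \<cdot> ?s) (shift 1 (iter G H ?j) \<cdot> ?s)"
      by (simp add: substs)
    then have step: "heq \<Gamma> B (\<tau> \<rightarrow>\<^sub>t \<sigma>) (Lam \<tau> (?\<Phi> \<cdot> ?s)) (Lam \<tau> (shift 1 (iter G H ?j) \<cdot> ?s))"
      by (rule heq_Lam)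
    have "heq \<Gamma> B \<sigma> ?l (iter G H (remaining s) \<cdot> s)"
      by (rule \<Phi>_inside[OF B(2) types B(4)])
    also have "heq \<Gamma> B \<sigma> \<dots> (iter G H (Succ \<cdot> ?j) \<cdot> s)"
      by (rule iter_cong[OF types heq_mono[OF Succ B(1)]])
    also have "heq \<Gamma> B \<sigma> \<dots> (H \<cdot> s \<cdot> Lam \<tau> (shift 1 (iter G H ?j) \<cdot> ?s))"
      by (rule iter_Succ) simp_all
    also have "heq \<Gamma> B \<sigma> \<dots> (H \<cdot> s \<cdot> Lam \<tau> (?\<Phi> \<cdot> ?s))"
      by (rule heq_App[OF _ heq_sym[OF step]], rule heq_refl) simp
    finally show "heq \<Gamma> B \<sigma> ?l (H \<cdot> s \<cdot> Lam \<tau> (?\<Phi> \<cdot> ?s))" .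
  next
    fix B assume B: "A \<subseteq> B" "bar_hyps \<Gamma> B S \<Delta>" "HA \<Gamma> B (\<^bold>\<not> at S 0 s)"
    let ?b = "H \<cdot> s \<cdot> Lam \<tau> (?\<Phi> \<cdot> ?s)"
    have b: "type_of \<Gamma> ?b = Some \<sigma>"
      by (simp add: br_ty_def)
    have "heq \<Gamma> B \<sigma> ?l (if_zero \<sigma> (remaining s) (G \<cdot> s) ?b)"
      by (rule \<Phi>_outside[OF B(2) types B(3)])
    also have "heq \<Gamma> B \<sigma> \<dots> (if_zero \<sigma> (Succ \<cdot> ?j) (G \<cdot> s) ?b)"
      by (rule heq_cong(5)[OF heq_mono[OF Succ B(1)] _ b]) simp
    also have "heq \<Gamma> B \<sigma> \<dots> ?b"
      by (rule if_zero_Succ[OF _ b]) simp_all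
    finally show "heq \<Gamma> B \<sigma> ?l ?b" .
  }
qed

lemma \<Phi>_BR:
  assumes hyps: "bar_hyps \<Gamma> A S \<Delta>"
  shows "HA \<Gamma> A (BR \<tau> \<sigma> (\<Phi> \<cdot> \<Delta>) t)"
proof -
  let ?\<Gamma> = "SeqT \<tau> # H_ty # G_ty # \<Gamma>" and ?A = "shift_fm ` shift_fm ` shift_fm ` A"
  let ?S = "weaken_pred (weaken_pred (weaken_pred S))" and ?\<Delta> = "shift 1 (shift 1 (shift 1 \<Delta>))"
  let ?stop = "less_fm (t \<cdot> (Hat \<tau> \<cdot> Var 0)) (Len \<tau> \<cdot> Var 0)"
  let ?continue = "le_fm (Len \<tau> \<cdot> Var 0) (t \<cdot> (Hat \<tau> \<cdot> Var 0))"
  \<comment> \<open>One shift for each of \<open>G\<close>, \<open>H\<close> and \<open>s\<close>,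
    which become \<open>Var 2\<close>, \<open>Var 1\<close> and \<open>Var 0\<close>;
    \<open>\<phi>\<close> will be either of the two case conditions.\<close>
  have hyps': "bar_hyps ?\<Gamma> (insert \<phi> ?A) ?S ?\<Delta>" for \<phi>
    by (rule bar_hyps_mono[OF bar_hyps_shift[OF bar_hyps_shift[OF bar_hyps_shift[OF hyps]]]]) auto
  have wf: "wf_fm ?\<Gamma> ?stop" "wf_fm ?\<Gamma> ?continue"
    by (simp_all add: less_fm_def le_fm_def)
  have "HA ?\<Gamma> (insert ?stop ?A) (Eq \<sigma> (\<Phi> \<cdot> ?\<Delta> \<cdot> Var 2 \<cdot> Var 1 \<cdot> Var 0) (Var 2 \<cdot> Var 0))"
    using \<Phi>_stop[OF hyps', of "Var 2" "Var 1" "Var 0" ?stop] HA.Assm[OF _ wf(1)]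
    by (simp add: heq_def)
  moreover have "HA ?\<Gamma> (insert ?continue ?A) (Eq \<sigma> (\<Phi> \<cdot> ?\<Delta> \<cdot> Var 2 \<cdot> Var 1 \<cdot> Var 0)
      (Var 1 \<cdot> Var 0 \<cdot> Lam \<tau> (shift 1 (\<Phi> \<cdot> ?\<Delta> \<cdot> Var 2 \<cdot> Var 1) \<cdot> (Snoc \<tau> \<cdot> Var 1 \<cdot> Var 0))))"
    using \<Phi>_continue[OF hyps', of "Var 2" "Var 1" "Var 0" ?continue] HA.Assm[OF _ wf(2)]
    by (simp add: heq_def shift_def)
  ultimately show ?thesis
    using wf unfolding BR_def bar_rec_def
    by (intro HA.AllI HA.ConjI HA.ImpI) (simp_all add: substs)
qed

end

theorem theorem2p4:
  fixes \<tau> \<sigma> :: ty and i :: nat and t :: tm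
  assumes "i = max (1 + level \<tau>) (level \<sigma>)"
    and "typed [] t ((NatT \<rightarrow>\<^sub>t \<tau>) \<rightarrow>\<^sub>t NatT)" and "in_T i t"
  shows "\<exists>\<Phi>. typed [] \<Phi> (br_ty \<tau> \<sigma> \<rightarrow>\<^sub>t br_ty \<tau> \<sigma>) \<and> in_T i \<Phi> \<and>
    (\<forall>\<Gamma> S. wf_fm (SeqT \<tau> # \<Gamma>) S \<longrightarrow>
      HA \<Gamma> {}
        (is_bar \<tau> S \<^bold>\<and> secures \<tau> S t \<^bold>\<longrightarrow>
          All (br_ty \<tau> \<sigma>)
            (GBR \<tau> \<sigma> (weaken_pred S) (Var 0) \<^bold>\<longrightarrow> BR \<tau> \<sigma> (\<Phi> \<cdot> Var 0) t)))"
proof -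
  interpret secured_functional \<tau> \<sigma> t
    by unfold_locales (rule assms(2))
  show ?thesis
  proof (intro exI[of _ \<Phi>] conjI allI impI)
    show "typed [] \<Phi> (br_ty \<tau> \<sigma> \<rightarrow>\<^sub>t br_ty \<tau> \<sigma>)"
      by simp
    show "in_T i \<Phi>"
      by (rule in_T_\<Phi>[OF assms(3)]) (simp add: assms(1))
    fix \<Gamma> S
    assume S: "wf_fm (SeqT \<tau> # \<Gamma>) S"
    let ?bar = "is_bar \<tau> S" and ?sec = "secures \<tau> S t"
    let ?gbr = "GBR \<tau> \<sigma> (weaken_pred S) (Var 0)"
    let ?goal = "All (br_ty \<tau> \<sigma>) (?gbr \<^bold>\<longrightarrow> BR \<tau> \<sigma> (\<Phi> \<cdot> Var 0) t)"
    note wf = wf_bar_fms[OF S] wf_weaken_pred[OF S]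
    have all: "HA \<Gamma> (insert ?sec (insert ?bar A)) ?goal" for A
    proof (intro HA.AllI HA.ImpI)
      let ?A = "insert ?gbr (shift_fm ` insert ?sec (insert ?bar A))"
      show "wf_fm (br_ty \<tau> \<sigma> # \<Gamma>) ?gbr"
        by (rule wf_bar_fms) (simp_all add: wf)
      have "bar_hyps (br_ty \<tau> \<sigma> # \<Gamma>) ?A (weaken_pred S) (Var 0)"
        by (simp add: bar_hyps_def wf)
      then show "HA (br_ty \<tau> \<sigma> # \<Gamma>) ?A (BR \<tau> \<sigma> (\<Phi> \<cdot> Var 0) t)"
        by (rule \<Phi>_BR)
    qed
    have both: "HA \<Gamma> {?bar \<^bold>\<and> ?sec} (?bar \<^bold>\<and> ?sec)"
      by (rule HA.Assm) (simp_all add: wf)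
    have "HA \<Gamma> {?bar \<^bold>\<and> ?sec} ?goal"
      \<comment> \<open>\<open>bar_hyps\<close> requires both conjuncts to be members of the
        assumption set, so they are cut in one after the other.\<close>
      by (rule HA_cut[OF HA.ConjE1[OF both] wf(1)],
          rule HA_cut[OF HA_mono[OF HA.ConjE2[OF both]] wf(2) all]) auto
    then show "HA \<Gamma> {} (?bar \<^bold>\<and> ?sec \<^bold>\<longrightarrow> ?goal)"
      by (intro HA.ImpI) (simp_all add: wf)
  qed
qed

end
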